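(* Let $k>2$ and $\epsilon>0$ be constants, and let $H_n:\{0,1\}^{\binom n2}\to\{0,1\}$ be the function giving the number of $k$-cliques modulo $2$ of an $n$-vertex simple undirected graph. With probability at least $1-2^{-\Omega(n^2)}$ over the randomness of sampling an oracle $O$ from $O^{H_n}_{1/2+\epsilon}$, there is an $\tilde O(n^2)$-time randomized reduction from counting $k$-cliques modulo $2$ on all $n$-vertex simple undirected graphs to the oracle $O$ (which counts $k$-cliques modulo $2$ correctly on the $(1/2+\epsilon)$-fraction of instances required of it); moreover this reduction succeeds on every input with probability greater than $2/3$.
   Context: An $n$-vertex simple undirected graph is identified with its edge indicator vector in $\{0,1\}^{\binom{n}{2}}$. The random experiment $O^{H_n}_{c}$: given an isomorphism-invariant function $H_n$ on $\{0,1\}^{\binom{n}{2}}$, select uniformly at random a set $S\subset\{0,1\}^{\binom n2}$ of size $c\,2^{\binom n2}$ and output an oracle $O$ that answers $H_n(x)$ correctly for every $x\in S$; answers outside $S$ are arbitrary. $\tilde O(f)$ means $O(f\cdot\mathrm{polylog}(n))$. *)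

theory Defs
  imports
    "HOL-Probability.Probability"
    "HOL-Library.Ramsey"
    "HOL-Library.Log_Nat"
    "HOL-Library.Landau_Symbols"
begin

section \<open>Graphs and clique parity\<close>

text \<open>An \<open>n\<close>-vertex simple undirected graph is its edge set, a set of two-element subsets of
  \<open>{..<n}\<close>; this is the 0/1 edge indicator vector of length \<open>n choose 2\<close> in set form.
  The codomain \<open>{0,1}\<close> of a function on graphs is rendered as \<^typ>\<open>bool\<close>.\<close>

type_synonym graph = "nat set set"

definition graphs :: "nat \<Rightarrow> graph set" where
  "graphs n = Pow (nsets {..<n} 2)"

definition clique_parity :: "nat \<Rightarrow> nat \<Rightarrow> graph \<Rightarrow> bool" where
  "clique_parity k n x \<longleftrightarrow> odd (card {C \<in> nsets {..<n} k. clique C x})"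

definition iso_invariant :: "nat \<Rightarrow> (graph \<Rightarrow> bool) \<Rightarrow> bool" where
  "iso_invariant n H \<longleftrightarrow>
     (\<forall>x\<in>graphs n. \<forall>\<pi>. bij_betw \<pi> {..<n} {..<n} \<longrightarrow> H ((`) \<pi> ` x) = H x)"


section \<open>The random oracle experiment\<close>

text \<open>The set \<open>S\<close> of correctly answered instances is uniform among the sets of
  \<open>c * 2 ^ (n choose 2)\<close> graphs, the size being rounded down when it is not an integer.
  For \<open>0 \<le> c \<le> 1\<close> such sets exist. Since the answers outside \<open>S\<close> are arbitrary, the outcome \<open>S\<close>
  is compatible with every oracle in \<open>oracles H S\<close>.\<close>

definition correct_sets :: "nat \<Rightarrow> real \<Rightarrow> graph set set" where
  "correct_sets n c = {S. S \<subseteq> graphs n \<and> card S = nat \<lfloor>c * 2 ^ (n choose 2)\<rfloor>}"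

definition oracle_experiment :: "nat \<Rightarrow> real \<Rightarrow> graph set pmf" where
  "oracle_experiment n c = pmf_of_set (correct_sets n c)"

definition oracles :: "(graph \<Rightarrow> bool) \<Rightarrow> graph set \<Rightarrow> (graph \<Rightarrow> bool) set" where
  "oracles H S = {Orc. \<forall>x\<in>S. Orc x = H x}"


section \<open>Randomized oracle machines\<close>

text \<open>Programs of a random access machine, in structured form, under the logarithmic cost
  criterion. A program uses finitely many registers, each holding a natural number, and a memory
  of natural numbers that is addressed indirectly through \<open>Load\<close> and \<open>Store\<close>. \<open>Coin r\<close> puts a fair
  random bit into register \<open>r\<close>. \<open>Query r e\<close> submits the graph whose edge indicator vector
  is stored in the memory from address \<open>e\<close> onwards, and puts the answer into register \<open>r\<close>.\<close>

type_synonym regs = "nat \<Rightarrow> nat"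
type_synonym mem = "nat \<Rightarrow> nat"

datatype expr =
    Const nat
  | Reg nat
  | Load expr
  | Plus expr expr
  | Minus expr expr
  | Times expr expr
  | Div expr expr

datatype com =
    Skip
  | Assign nat expr
  | Store expr expr
  | Seq com com
  | IfElse expr com com
  | While expr com
  | Coin nat
  | Query nat expr

text \<open>\<open>Minus\<close> is truncated subtraction, and division by zero yields zero.\<close>

fun eval :: "regs \<Rightarrow> mem \<Rightarrow> expr \<Rightarrow> nat" where
  "eval R M (Const c) = c"
| "eval R M (Reg r) = R r"
| "eval R M (Load e) = M (eval R M e)"
| "eval R M (Plus e1 e2) = eval R M e1 + eval R M e2"
| "eval R M (Minus e1 e2) = eval R M e1 - eval R M e2"
| "eval R M (Times e1 e2) = eval R M e1 * eval R M e2"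
| "eval R M (Div e1 e2) = eval R M e1 div eval R M e2"

text \<open>\<^term>\<open>floorlog 2 v\<close> is the number of binary digits of \<open>v\<close>, so every value that occurs
  during an evaluation, operands and addresses included, is charged its binary length.\<close>

fun cost :: "regs \<Rightarrow> mem \<Rightarrow> expr \<Rightarrow> nat" where
  "cost R M (Const c) = 1 + floorlog 2 c"
| "cost R M (Reg r) = 1 + floorlog 2 (R r)"
| "cost R M (Load e) = cost R M e + 1 + floorlog 2 (eval R M (Load e))"
| "cost R M (Plus e1 e2) = cost R M e1 + cost R M e2 + 1 + floorlog 2 (eval R M (Plus e1 e2))"
| "cost R M (Minus e1 e2) = cost R M e1 + cost R M e2 + 1 + floorlog 2 (eval R M (Minus e1 e2))"
| "cost R M (Times e1 e2) = cost R M e1 + cost R M e2 + 1 + floorlog 2 (eval R M (Times e1 e2))"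
| "cost R M (Div e1 e2) = cost R M e1 + cost R M e2 + 1 + floorlog 2 (eval R M (Div e1 e2))"

text \<open>Position of the edge \<open>{i, j}\<close>, for \<open>i < j\<close>, in the edge indicator vector. For \<open>j < n\<close> these
  positions enumerate \<open>{..<n choose 2}\<close>.\<close>

definition edge_index :: "nat \<Rightarrow> nat \<Rightarrow> nat" where
  "edge_index i j = (j choose 2) + i"

definition graph_at :: "nat \<Rightarrow> nat \<Rightarrow> mem \<Rightarrow> graph" where
  "graph_at n a M = {{i, j} | i j. i < j \<and> j < n \<and> M (a + edge_index i j) \<noteq> 0}"

definition init_regs :: "nat \<Rightarrow> regs" where
  "init_regs n = (\<lambda>r. if r = 0 then n else 0)"

definition init_mem :: "nat \<Rightarrow> graph \<Rightarrow> mem" where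
  "init_mem n x =
     (\<lambda>a. of_bool (\<exists>i j. i < j \<and> j < n \<and> {i, j} \<in> x \<and> a = edge_index i j))"

text \<open>\<open>steps n Orc p R M w t R' M' w'\<close>: with oracle \<open>Orc\<close> for \<open>n\<close>-vertex graphs, program \<open>p\<close>
  started with registers \<open>R\<close> and memory \<open>M\<close> terminates in time \<open>t\<close> with registers \<open>R'\<close> and
  memory \<open>M'\<close>, where \<open>w\<close> and \<open>w'\<close> are the unused coin flips before and after. A run that needs
  more coin flips than \<open>w\<close> provides does not terminate. A query is charged the
  number of bits submitted in addition to the evaluation of its address.\<close>

inductive steps ::
  "nat \<Rightarrow> (graph \<Rightarrow> bool) \<Rightarrow> com \<Rightarrow> regs \<Rightarrow> mem \<Rightarrow> bool list \<Rightarrow>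
   nat \<Rightarrow> regs \<Rightarrow> mem \<Rightarrow> bool list \<Rightarrow> bool"
  for n :: nat and Orc :: "graph \<Rightarrow> bool"
where
  Skip: "steps n Orc Skip R M w 1 R M w"
| Assign: "steps n Orc (Assign r e) R M w (1 + cost R M e) (R(r := eval R M e)) M w"
| Store: "steps n Orc (Store e1 e2) R M w (1 + cost R M e1 + cost R M e2)
            R (M(eval R M e1 := eval R M e2)) w"
| Seq: "steps n Orc p R M w t R' M' w' \<Longrightarrow> steps n Orc q R' M' w' t' R'' M'' w'' \<Longrightarrow>
          steps n Orc (Seq p q) R M w (t + t') R'' M'' w''"
| IfTrue: "eval R M e \<noteq> 0 \<Longrightarrow> steps n Orc p R M w t R' M' w' \<Longrightarrow>
             steps n Orc (IfElse e p q) R M w (1 + cost R M e + t) R' M' w'"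
| IfFalse: "eval R M e = 0 \<Longrightarrow> steps n Orc q R M w t R' M' w' \<Longrightarrow>
              steps n Orc (IfElse e p q) R M w (1 + cost R M e + t) R' M' w'"
| WhileTrue: "eval R M e \<noteq> 0 \<Longrightarrow> steps n Orc p R M w t R' M' w' \<Longrightarrow>
                steps n Orc (While e p) R' M' w' t' R'' M'' w'' \<Longrightarrow>
                steps n Orc (While e p) R M w (1 + cost R M e + t + t') R'' M'' w''"
| WhileFalse: "eval R M e = 0 \<Longrightarrow>
                 steps n Orc (While e p) R M w (1 + cost R M e) R M w"
| Coin: "steps n Orc (Coin r) R M (b # w) 1 (R(r := of_bool b)) M w"
| Query: "steps n Orc (Query r e) R M w (1 + cost R M e + (n choose 2))
            (R(r := of_bool (Orc (graph_at n (eval R M e) M)))) M w"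

text \<open>Input: \<open>n\<close> in register 0 and the edge indicator vector in the memory from address 0 onwards.
  Output: the bit in register 0.\<close>

definition halts_within ::
  "nat \<Rightarrow> (graph \<Rightarrow> bool) \<Rightarrow> com \<Rightarrow> graph \<Rightarrow> bool list \<Rightarrow> nat \<Rightarrow> bool" where
  "halts_within n Orc p x w T \<longleftrightarrow>
     (\<exists>t R M w'. steps n Orc p (init_regs n) (init_mem n x) w t R M w' \<and> t \<le> T)"

definition outputs ::
  "nat \<Rightarrow> (graph \<Rightarrow> bool) \<Rightarrow> com \<Rightarrow> graph \<Rightarrow> bool list \<Rightarrow> bool \<Rightarrow> bool" where
  "outputs n Orc p x w b \<longleftrightarrow>
     (\<exists>t R M w'. steps n Orc p (init_regs n) (init_mem n x) w t R M w' \<and> R 0 = of_bool b)"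

text \<open>Since every coin flip takes time, a run of time at most \<open>T\<close> uses at most \<open>T\<close> flips, so
  randomness is modelled by \<open>T\<close> independent fair bits. The time bound is worst-case: it holds for
  every input and every outcome of the flips.\<close>

definition coins :: "nat \<Rightarrow> bool list pmf" where
  "coins T = pmf_of_set {w. length w = T}"

definition randomized_reduction ::
  "nat \<Rightarrow> (graph \<Rightarrow> bool) \<Rightarrow> (graph \<Rightarrow> bool) \<Rightarrow> com \<Rightarrow> nat \<Rightarrow> bool" where
  "randomized_reduction n H Orc p T \<longleftrightarrow>
     (\<forall>x\<in>graphs n.
        (\<forall>w. length w = T \<longrightarrow> halts_within n Orc p x w T) \<and>
        measure_pmf.prob (coins T) {w. outputs n Orc p x w (H x)} > 2 / 3)"

definition soft_O :: "(nat \<Rightarrow> real) \<Rightarrow> (nat \<Rightarrow> real) set" where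
  "soft_O f = (\<Union>d::nat. O(\<lambda>n. f n * ln (real n) ^ d))"


section \<open>Consistency of the definitions\<close>

lemma card_graphs: "finite (graphs n)" "card (graphs n) = 2 ^ (n choose 2)"
  by (simp_all add: graphs_def card_Pow finite_imp_finite_nsets card_nsets)

lemma correct_sets_nonempty:
  assumes "0 \<le> c" "c \<le> 1"
  shows "finite (correct_sets n c)" "correct_sets n c \<noteq> {}"
proof -
  show "finite (correct_sets n c)"
    using card_graphs(1)[of n] by (auto simp: correct_sets_def)
  have "c * 2 ^ (n choose 2) \<le> 1 * 2 ^ (n choose 2)"
    using assms by (intro mult_right_mono) auto
  also have "\<dots> = real (card (graphs n))"
    by (simp add: card_graphs)
  finally have "nat \<lfloor>c * 2 ^ (n choose 2)\<rfloor> \<le> card (graphs n)"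
    by linarith
  then show "correct_sets n c \<noteq> {}"
    using obtain_subset_with_card_n[of "nat \<lfloor>c * 2 ^ (n choose 2)\<rfloor>" "graphs n"]
    by (auto simp: correct_sets_def)
qed

lemma edge_index_less: "i < j \<Longrightarrow> j < n \<Longrightarrow> edge_index i j < n choose 2"
proof -
  assume "i < j" "j < n"
  then have "edge_index i j < Suc j choose 2"
    by (simp add: edge_index_def numeral_2_eq_2)
  also have "\<dots> \<le> n choose 2"
    using \<open>j < n\<close> by (intro binomial_right_mono) auto
  finally show ?thesis .
qed

lemma edge_index_inj:
  assumes "i < j" "i' < j'" "edge_index i j = edge_index i' j'"
  shows "i = i' \<and> j = j'"
proof -
  have *: "edge_index a b < edge_index a' b'" if "a < b" "b < b'" for a b a' b'
    using edge_index_less[OF that] by (simp add: edge_index_def)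
  have "j = j'"
    using assms *[of i j j' i'] *[of i' j' j i] by (metis less_irrefl nat_neq_iff)
  then show ?thesis
    using assms by (simp add: edge_index_def)
qed

lemma graph_at_init_mem:
  assumes "x \<in> graphs n"
  shows "graph_at n 0 (init_mem n x) = x"
proof -
  have "graph_at n 0 (init_mem n x) = {{i, j} | i j. i < j \<and> j < n \<and> {i, j} \<in> x}"
    by (auto simp: graph_at_def init_mem_def dest: edge_index_inj)
  also have "\<dots> = x"
  proof (intro equalityI subsetI)
    fix e assume "e \<in> x"
    then have "e \<in> nsets {..<n} 2"
      using assms by (auto simp: graphs_def)
    then obtain i j where "e = {i, j}" "i < n" "j < n" "i \<noteq> j"
      by (auto simp: nsets_2_eq)
    then have "\<exists>i j. e = {i, j} \<and> i < j \<and> j < n"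
      by (metis insert_commute nat_neq_iff)
    then show "e \<in> {{i, j} | i j. i < j \<and> j < n \<and> {i, j} \<in> x}"
      using \<open>e \<in> x\<close> by blast
  qed auto
  finally show ?thesis .
qed

lemma steps_deterministic:
  "steps n Orc p R M w t R1 M1 w1 \<Longrightarrow> steps n Orc p R M w t' R2 M2 w2 \<Longrightarrow>
     t = t' \<and> R1 = R2 \<and> M1 = M2 \<and> w1 = w2"
proof (induction arbitrary: t' R2 M2 w2 rule: steps.induct)
  case (Seq p R M w t R' M' w' q t'' R'' M'' w'')
  from Seq.prems show ?case
    by cases (metis Seq.IH)
next
  case (WhileTrue R M e p w t R' M' w' t'' R'' M'' w'')
  from WhileTrue.prems show ?case
    by cases (use WhileTrue.IH WhileTrue.hyps in metis)+
next
  case (IfTrue R M e p w t R' M' w' q)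
  from IfTrue.prems show ?case
    by cases (use IfTrue.IH IfTrue.hyps in metis)+
next
  case (IfFalse R M e q w t R' M' w' p)
  from IfFalse.prems show ?case
    by cases (use IfFalse.IH IfFalse.hyps in metis)+
qed (auto elim: steps.cases)

lemma iso_invariant_clique_parity: "iso_invariant n (clique_parity k n)"
  unfolding iso_invariant_def
proof (intro ballI allI impI)
  fix x and \<pi> :: "nat \<Rightarrow> nat"
  assume x: "x \<in> graphs n" and \<pi>: "bij_betw \<pi> {..<n} {..<n}"
  have inj: "inj_on \<pi> {..<n}" and img: "\<pi> ` {..<n} = {..<n}"
    using \<pi> by (auto simp: bij_betw_def)
  have xsub: "x \<subseteq> Pow {..<n}"
    using x by (auto simp: graphs_def nsets_def)
  have mem: "\<pi> ` e \<in> (`) \<pi> ` x \<longleftrightarrow> e \<in> x" if "e \<subseteq> {..<n}" for e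
    using inj_on_image_mem_iff[OF inj_on_image_Pow[OF inj], of e x] that xsub by auto
  have cl: "clique (\<pi> ` C) ((`) \<pi> ` x) \<longleftrightarrow> clique C x" if C: "C \<subseteq> {..<n}" for C
  proof -
    have *: "{\<pi> v, \<pi> w} \<in> (`) \<pi> ` x \<longleftrightarrow> {v, w} \<in> x" "\<pi> v = \<pi> w \<longleftrightarrow> v = w"
      if "v \<in> C" "w \<in> C" for v w
      using mem[of "{v, w}"] that C inj by (auto dest: inj_onD)
    then show ?thesis
      by (simp add: clique_def)
  qed
  have "bij_betw ((`) \<pi>) {C \<in> nsets {..<n} k. clique C x}
          {C \<in> nsets {..<n} k. clique C ((`) \<pi> ` x)}"
  proof (rule bij_betw_imageI)
    show "inj_on ((`) \<pi>) {C \<in> nsets {..<n} k. clique C x}"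
      by (rule inj_on_subset[OF inj_on_image_Pow[OF inj]]) (auto simp: nsets_def)
    have "\<exists>C\<in>{C \<in> nsets {..<n} k. clique C x}. D = \<pi> ` C"
      if D: "D \<in> nsets {..<n} k" "clique D ((`) \<pi> ` x)" for D
    proof -
      have "D \<subseteq> \<pi> ` {..<n}"
        using D img by (auto simp: nsets_def)
      then obtain C where C: "C \<subseteq> {..<n}" "D = \<pi> ` C"
        by (auto simp: subset_image_iff)
      then have "C \<in> nsets {..<n} k"
        using D inj_on_subset[OF inj C(1)] finite_subset[OF C(1)]
        by (auto simp: nsets_def card_image)
      then show ?thesis
        using C D cl by auto
    qed
    moreover have "\<pi> ` C \<in> {C \<in> nsets {..<n} k. clique C ((`) \<pi> ` x)}"
      if C: "C \<in> nsets {..<n} k" "clique C x" for C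
      using that cl[of C] img inj_on_subset[OF inj, of C]
      by (auto simp: nsets_def card_image)
    ultimately show "(`) \<pi> ` {C \<in> nsets {..<n} k. clique C x}
        = {C \<in> nsets {..<n} k. clique C ((`) \<pi> ` x)}"
      by blast
  qed
  then show "clique_parity k n ((`) \<pi> ` x) = clique_parity k n x"
    by (simp add: clique_parity_def bij_betw_same_card)
qed

end

theory Submission
  imports Defs "HOL-Real_Asymp.Real_Asymp"
begin

text \<open>A single query suffices per trial, provided the query has the same clique parity as the input
  and high min-entropy; such queries are found as follows. Let \<open>K = 2 ^ k\<close>. If \<open>K\<close> consecutive
  vertices are pairwise twins, then the cliques that meet this block cancel modulo 2, because
  \<open>2 ^ k choose s\<close> is even for \<open>0 < s \<le> k\<close>; hence the parity survives when every other vertex is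
  randomly reconnected to the whole block. Otherwise there are about \<open>n / K\<close> disjoint pairs of
  consecutive vertices that are not twins, and swapping each of them with probability \<open>1/2\<close> gives
  an isomorphic graph. In both cases every single graph is queried with probability \<open>2 ^ -\<Omega>(n)\<close>, so
  for a fixed input a Chernoff bound for the random set \<open>S\<close> shows that all but a doubly exponentially
  small fraction of the sets \<open>S\<close> contain the query with probability at least \<open>1/2 + \<epsilon>/4\<close>; a union
  bound over the \<open>2 ^ (n choose 2)\<close> inputs is affordable. The majority over constantly many trials,
  each starting from the graph left behind by the previous one, is then correct.\<close>

text \<open>Relabelling vertices at random keeps the parity but need not randomize the query: a
  graph with many symmetries, such as the empty or the complete one, has a small orbit. The twin
  dichotomy answers this: a swap that leaves the graph fixed is itself a symmetry, and enough such
  symmetry in one place permits parity-preserving changes that may leave the isomorphism class.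
  Answers outside \<open>S\<close> are adversarial, so a query counts only through its probability
  of landing in \<open>S\<close>. If no graph is queried with probability above \<open>P\<close>,
  the deviation bound is \<open>exp (- \<delta>^2 / (2 * P))\<close>. Hence min-entropy of twice the
  binary logarithm of \<open>n\<close> plus a constant already beats the number of graphs; the
  linear amount obtained here leaves a wide margin. A query costs about \<open>n ^ 2\<close>, so few
  are affordable; a constant number suffices because the advantage is constant. The union bound
  makes \<open>S\<close> good for all start graphs at once, in particular for those reached by
  earlier trials, so the input never has to be restored.\<close>

subsection \<open>Time-bounded weakest preconditions\<close>

text \<open>Constants get size \<open>c + 1\<close> because \<open>c \<le> 2 ^ c\<close>: then \<open>n ^ esize e\<close> bounds the value of \<open>e\<close>
  whenever all stored values are at most \<open>n \<ge> 2\<close>.\<close>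

fun esize :: "expr \<Rightarrow> nat" where
  "esize (Const c) = c + 1"
| "esize (Reg r) = 1"
| "esize (Load e) = esize e + 1"
| "esize (Plus e1 e2) = esize e1 + esize e2 + 1"
| "esize (Minus e1 e2) = esize e1 + esize e2 + 1"
| "esize (Times e1 e2) = esize e1 + esize e2 + 1"
| "esize (Div e1 e2) = esize e1 + esize e2 + 1"

fun ecost :: "expr \<Rightarrow> nat" where
  "ecost (Const c) = 1 + esize (Const c)"
| "ecost (Reg r) = 2"
| "ecost (Load e) = ecost e + 1 + esize (Load e)"
| "ecost (Plus e1 e2) = ecost e1 + ecost e2 + 1 + esize (Plus e1 e2)"
| "ecost (Minus e1 e2) = ecost e1 + ecost e2 + 1 + esize (Minus e1 e2)"
| "ecost (Times e1 e2) = ecost e1 + ecost e2 + 1 + esize (Times e1 e2)"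
| "ecost (Div e1 e2) = ecost e1 + ecost e2 + 1 + esize (Div e1 e2)"

definition bounded_state :: "nat \<Rightarrow> regs \<Rightarrow> mem \<Rightarrow> bool" where
  "bounded_state n R M \<longleftrightarrow> (\<forall>r. R r \<le> n) \<and> (\<forall>a. M a \<le> n)"

lemma bounded_state_reg: "bounded_state n R M \<Longrightarrow> v \<le> n \<Longrightarrow> bounded_state n (R(r := v)) M"
  by (simp add: bounded_state_def)

lemma bounded_state_mem: "bounded_state n R M \<Longrightarrow> v \<le> n \<Longrightarrow> bounded_state n R (M(a := v))"
  by (simp add: bounded_state_def)

lemma eval_le_power:
  assumes "bounded_state n R M" "2 \<le> n"
  shows "eval R M e \<le> n ^ esize e"
proof (induction e)
  case (Const c)
  have "c \<le> 2 ^ c" by simp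
  also have "\<dots> \<le> n ^ c" using assms by (intro power_mono) auto
  also have "\<dots> \<le> n ^ (c + 1)" using assms by (intro power_increasing) auto
  finally show ?case by simp
next
  case (Reg r)
  then show ?case using assms by (simp add: bounded_state_def)
next
  case (Load e)
  have "M (eval R M e) \<le> n ^ 1" using assms by (simp add: bounded_state_def)
  also have "\<dots> \<le> n ^ (esize e + 1)" using assms by (intro power_increasing) auto
  finally show ?case by simp
next
  case (Plus e1 e2)
  have p: "1 \<le> n ^ k" for k using assms by simp
  have "eval R M (Plus e1 e2) \<le> n ^ esize e1 + n ^ esize e2" using Plus by simp
  also have "\<dots> \<le> n ^ esize e1 * n ^ esize e2 + n ^ esize e1 * n ^ esize e2"
    using p[of "esize e1"] p[of "esize e2"] by (intro add_mono) auto
  also have "\<dots> = 2 * n ^ (esize e1 + esize e2)" by (simp add: power_add)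
  also have "\<dots> \<le> n * n ^ (esize e1 + esize e2)" using assms by (intro mult_right_mono) auto
  finally show ?case by simp
next
  case (Minus e1 e2)
  have "eval R M (Minus e1 e2) \<le> n ^ esize e1" using Minus by simp
  also have "\<dots> \<le> n ^ esize (Minus e1 e2)" using assms by (intro power_increasing) auto
  finally show ?case .
next
  case (Times e1 e2)
  have "eval R M (Times e1 e2) \<le> n ^ esize e1 * n ^ esize e2" using Times by (simp add: mult_mono)
  also have "\<dots> = n ^ (esize e1 + esize e2)" by (simp add: power_add)
  also have "\<dots> \<le> n ^ esize (Times e1 e2)" using assms by (intro power_increasing) auto
  finally show ?case .
next
  case (Div e1 e2)
  have "eval R M (Div e1 e2) \<le> eval R M e1" by simp
  also have "\<dots> \<le> n ^ esize e1" using Div by simp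
  also have "\<dots> \<le> n ^ esize (Div e1 e2)" using assms by (intro power_increasing) auto
  finally show ?case .
qed

lemma floorlog_power_le:
  assumes "v \<le> n ^ s" "0 < s"
  shows "floorlog 2 v \<le> s * floorlog 2 n"
proof -
  have "n < 2 ^ floorlog 2 n"
    using floorlog_bounds[of n 2] by (cases "n = 0") auto
  then have "n ^ s < (2 ^ floorlog 2 n) ^ s" using assms(2) by (intro power_strict_mono) auto
  then have "v < 2 ^ (s * floorlog 2 n)" using assms(1) by (simp add: power_mult[symmetric] mult.commute)
  then show ?thesis by (intro floorlog_leI) auto
qed

lemma cost_le:
  assumes "bounded_state n R M" "2 \<le> n"
  shows "cost R M e \<le> ecost e * floorlog 2 n"
proof -
  have L: "1 \<le> floorlog 2 n" using assms by (intro floorlog_geI) auto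
  have sz: "0 < esize e" for e by (cases e) auto
  have f: "floorlog 2 (eval R M e) \<le> esize e * floorlog 2 n" for e
    by (rule floorlog_power_le[OF eval_le_power[OF assms] sz])
  show ?thesis
  proof (induction e)
    case (Const c)
    show ?case using f[of "Const c"] L by (simp add: algebra_simps)
  next
    case (Reg r)
    show ?case using f[of "Reg r"] L by (simp add: algebra_simps)
  next
    case (Load e)
    show ?case using f[of "Load e"] L Load.IH by (simp add: algebra_simps)
  next
    case (Plus e1 e2)
    show ?case using f[of "Plus e1 e2"] L Plus.IH by (simp add: algebra_simps)
  next
    case (Minus e1 e2)
    show ?case using f[of "Minus e1 e2"] L Minus.IH by (simp add: algebra_simps)
  next
    case (Times e1 e2)
    show ?case using f[of "Times e1 e2"] L Times.IH by (simp add: algebra_simps)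
  next
    case (Div e1 e2)
    show ?case using f[of "Div e1 e2"] L Div.IH by (simp add: algebra_simps)
  qed
qed

text \<open>A time bound for runs in which every loop makes at most \<open>n\<close> iterations and all stored
  values stay below \<open>n\<close>.\<close>

fun time_bound :: "nat \<Rightarrow> com \<Rightarrow> nat" where
  "time_bound n Skip = 1"
| "time_bound n (Assign r e) = 1 + ecost e * floorlog 2 n"
| "time_bound n (Store e1 e2) = 1 + ecost e1 * floorlog 2 n + ecost e2 * floorlog 2 n"
| "time_bound n (Seq p q) = time_bound n p + time_bound n q"
| "time_bound n (IfElse e p q) = 1 + ecost e * floorlog 2 n + time_bound n p + time_bound n q"
| "time_bound n (While e p) = n * (1 + ecost e * floorlog 2 n + time_bound n p) + (1 + ecost e * floorlog 2 n)"
| "time_bound n (Coin r) = 1"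
| "time_bound n (Query r e) = 1 + ecost e * floorlog 2 n + (n choose 2)"

fun time_coeff :: "com \<Rightarrow> nat" where
  "time_coeff Skip = 1"
| "time_coeff (Assign r e) = 1 + ecost e"
| "time_coeff (Store e1 e2) = 1 + ecost e1 + ecost e2"
| "time_coeff (Seq p q) = time_coeff p + time_coeff q"
| "time_coeff (IfElse e p q) = 1 + ecost e + time_coeff p + time_coeff q"
| "time_coeff (While e p) = (1 + ecost e + time_coeff p) + (1 + ecost e)"
| "time_coeff (Coin r) = 1"
| "time_coeff (Query r e) = 2 + ecost e"

fun time_degree :: "com \<Rightarrow> nat" where
  "time_degree (Seq p q) = max (time_degree p) (time_degree q)"
| "time_degree (IfElse e p q) = max (time_degree p) (time_degree q)"
| "time_degree (While e p) = Suc (time_degree p)"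
| "time_degree (Query r e) = 2"
| "time_degree _ = 0"

text \<open>An evaluation costs a constant times \<open>floorlog 2 n\<close>, a loop multiplies by
  \<open>n\<close>, and a query pays about \<open>n ^ 2\<close>. The degree of the running time is
  therefore the nesting depth of loops, with a query counted as two levels, and can be read off the
  syntax.\<close>

lemma time_bound_le:
  assumes "2 \<le> n"
  shows "time_degree p \<le> d \<Longrightarrow> time_bound n p \<le> time_coeff p * (n ^ d * floorlog 2 n)"
proof (induction p arbitrary: d)
  have L: "1 \<le> floorlog 2 n" using assms by (intro floorlog_geI) auto
  have b: "1 + c * floorlog 2 n \<le> (1 + c) * (n ^ d * floorlog 2 n)" for c d
  proof -
    have "1 + c * floorlog 2 n \<le> (1 + c) * (1 * floorlog 2 n)" using L by simp
    also have "\<dots> \<le> (1 + c) * (n ^ d * floorlog 2 n)"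
      using assms by (intro mult_left_mono mult_right_mono) auto
    finally show ?thesis .
  qed
  {
    case Skip
    then show ?case using b[of 0 d] by simp
  next
    case (Assign r e)
    then show ?case using b[of "ecost e" d] by simp
  next
    case (Store e1 e2)
    then show ?case using b[of "ecost e1 + ecost e2" d] by (simp add: algebra_simps)
  next
    case (Seq p q)
    then show ?case using Seq.IH[of d] by (simp add: algebra_simps add_mono)
  next
    case (IfElse e p q)
    then have "time_bound n p \<le> time_coeff p * (n ^ d * floorlog 2 n)"
      "time_bound n q \<le> time_coeff q * (n ^ d * floorlog 2 n)" by simp_all
    then show ?case using b[of "ecost e" d]
      unfolding time_bound.simps time_coeff.simps add_mult_distrib by linarith
  next
    case (While e p)
    then obtain d' where d: "d = Suc d'" "time_degree p \<le> d'" by (cases d) auto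
    have "n * (1 + ecost e * floorlog 2 n + time_bound n p)
        \<le> n * ((1 + ecost e) * (n ^ d' * floorlog 2 n) + time_coeff p * (n ^ d' * floorlog 2 n))"
      using While.IH[OF d(2)] b[of "ecost e" d'] by (intro mult_left_mono add_mono) auto
    also have "\<dots> = (1 + ecost e + time_coeff p) * (n ^ d * floorlog 2 n)"
      by (simp add: d algebra_simps)
    finally show ?case using b[of "ecost e" d] by (simp add: algebra_simps)
  next
    case (Coin r)
    then show ?case using b[of 0 d] by simp
  next
    case (Query r e)
    have "n choose 2 \<le> n * n" by (simp add: choose_two div_le_mono le_trans[OF div_le_dividend])
    also have "\<dots> = n ^ 2 * 1" by (simp add: power2_eq_square)
    also have "\<dots> \<le> n ^ d * floorlog 2 n"
      using Query assms L by (intro mult_mono power_increasing) auto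
    finally show ?case using b[of "ecost e" d] by simp
  }
qed

context
  fixes n :: nat and Orc :: "graph \<Rightarrow> bool"
  assumes n2: "2 \<le> n"
begin

text \<open>Boundedness of the state is both assumed and re-established here, and the time bound
  depends only on the program text. Assertions can then speak of functional behaviour alone.\<close>

definition wp :: "com \<Rightarrow> (regs \<Rightarrow> mem \<Rightarrow> bool list \<Rightarrow> bool) \<Rightarrow> regs \<Rightarrow> mem \<Rightarrow> bool list \<Rightarrow> bool"
  where "wp p Q R M w \<longleftrightarrow> (bounded_state n R M \<longrightarrow>
     (\<exists>t R' M' w'. steps n Orc p R M w t R' M' w' \<and> t \<le> time_bound n p \<and>
        bounded_state n R' M' \<and> Q R' M' w'))"

lemma wpI:
  assumes "bounded_state n R M \<Longrightarrow> steps n Orc p R M w t R' M' w'"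
    and "bounded_state n R M \<Longrightarrow> t \<le> time_bound n p"
    and "bounded_state n R M \<Longrightarrow> bounded_state n R' M'" and "Q R' M' w'"
  shows "wp p Q R M w"
  using assms unfolding wp_def by blast

lemma wp_Skip: "Q R M w \<Longrightarrow> wp Skip Q R M w"
  by (rule wpI[OF Skip]) auto

lemma wp_Assign:
  assumes "eval R M e \<le> n" "Q (R(r := eval R M e)) M w"
  shows "wp (Assign r e) Q R M w"
  by (rule wpI[OF Assign]) (use assms cost_le[OF _ n2] in \<open>auto intro: bounded_state_reg\<close>)

lemma wp_Store:
  assumes "eval R M e2 \<le> n" "Q R (M(eval R M e1 := eval R M e2)) w"
  shows "wp (Store e1 e2) Q R M w"
  by (rule wpI[OF Store]) (use assms cost_le[OF _ n2] in \<open>auto intro: bounded_state_mem add_mono\<close>)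

lemma wp_Seq: "wp p (wp q Q) R M w \<Longrightarrow> wp (Seq p q) Q R M w"
  unfolding wp_def time_bound.simps using Seq add_mono by meson

lemma wp_If:
  assumes "eval R M e \<noteq> 0 \<Longrightarrow> wp p Q R M w" "eval R M e = 0 \<Longrightarrow> wp q Q R M w"
  shows "wp (IfElse e p q) Q R M w"
proof (cases "bounded_state n R M")
  case bd: True
  show ?thesis
  proof (cases "eval R M e = 0")
    case True
    from assms(2)[OF this] bd obtain t R' M' w' where
      "steps n Orc q R M w t R' M' w'" "t \<le> time_bound n q" "bounded_state n R' M'" "Q R' M' w'"
      unfolding wp_def by blast
    with True show ?thesis
      by (intro wpI[OF IfFalse]) (use cost_le[OF bd n2, of e] in auto)
  next
    case False
    from assms(1)[OF this] bd obtain t R' M' w' where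
      "steps n Orc p R M w t R' M' w'" "t \<le> time_bound n p" "bounded_state n R' M'" "Q R' M' w'"
      unfolding wp_def by blast
    with False show ?thesis
      by (intro wpI[OF IfTrue]) (use cost_le[OF bd n2, of e] in auto)
  qed
qed (simp add: wp_def)

lemma wp_Coin: "Q (R(r := of_bool b)) M w \<Longrightarrow> wp (Coin r) Q R M (b # w)"
  by (rule wpI[OF Coin]) (use n2 in \<open>auto intro!: bounded_state_reg\<close>)

lemma wp_Query:
  "Q (R(r := of_bool (Orc (graph_at n (eval R M e) M)))) M w \<Longrightarrow> wp (Query r e) Q R M w"
  by (rule wpI[OF Query]) (use n2 cost_le[OF _ n2] in \<open>auto intro!: bounded_state_reg\<close>)

text \<open>Indexing the invariant by the number of completed iterations fixes the iteration count
  at exactly \<open>N\<close>; this gives termination, and \<open>N \<le> n\<close> gives the time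
  bound of the loop.\<close>

lemma wp_While:
  assumes init: "I 0 R M w" and N: "N \<le> n"
    and step: "\<And>i R M w. i < N \<Longrightarrow> I i R M w \<Longrightarrow> wp p (I (Suc i)) R M w"
    and guard: "\<And>i R M w. i < N \<Longrightarrow> I i R M w \<Longrightarrow> eval R M e \<noteq> 0"
    and stop: "\<And>R M w. I N R M w \<Longrightarrow> eval R M e = 0"
    and post: "\<And>R M w. I N R M w \<Longrightarrow> Q R M w"
  shows "wp (While e p) Q R M w"
proof -
  let ?g = "1 + ecost e * floorlog 2 n"
  have "\<exists>t R' M' w'. steps n Orc (While e p) R M w t R' M' w' \<and> t \<le> (N - i) * (?g + time_bound n p) + ?g \<and>
       bounded_state n R' M' \<and> Q R' M' w'"
    if "i \<le> N" "I i R M w" "bounded_state n R M" for i R M w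
    using that
  proof (induction i arbitrary: R M w rule: inc_induct)
    case base
    then show ?case using WhileFalse[OF stop[OF base(1)]] post cost_le[OF base(2) n2, of e]
      by (intro exI[of _ "1 + cost R M e"] exI[of _ R] exI[of _ M] exI[of _ w]) auto
  next
    case (step i)
    obtain t R1 M1 w1 where 1: "steps n Orc p R M w t R1 M1 w1" "t \<le> time_bound n p"
      "bounded_state n R1 M1" "I (Suc i) R1 M1 w1"
      using assms(3)[OF step.hyps(2) step.prems(1)] step.prems(2) unfolding wp_def by blast
    obtain t' R' M' w' where 2: "steps n Orc (While e p) R1 M1 w1 t' R' M' w'"
      "t' \<le> (N - Suc i) * (?g + time_bound n p) + ?g" "bounded_state n R' M'" "Q R' M' w'"
      using step.IH[OF 1(4,3)] by blast
    have "N - i = Suc (N - Suc i)" using step.hyps by simp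
    then have "1 + cost R M e + t + t' \<le> (N - i) * (?g + time_bound n p) + ?g"
      using 1(2) 2(2) cost_le[OF step.prems(2) n2, of e] by simp
    then show ?case
      using WhileTrue[OF guard[OF step.hyps(2) step.prems(1)] 1(1) 2(1)] 2(3,4) by blast
  qed
  from this[of 0, OF _ init] have "bounded_state n R M \<Longrightarrow> \<exists>t R' M' w'. steps n Orc (While e p) R M w t R' M' w' \<and>
      t \<le> N * (?g + time_bound n p) + ?g \<and> bounded_state n R' M' \<and> Q R' M' w'" by simp
  moreover have "N * (?g + time_bound n p) + ?g \<le> time_bound n (While e p)"
    using mult_right_mono[OF N, of "?g + time_bound n p"] by simp
  ultimately show ?thesis unfolding wp_def by (meson le_trans)
qed

end

subsection \<open>Edge toggles and vertex swaps\<close>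

definition set_edge :: "graph \<Rightarrow> nat \<Rightarrow> nat \<Rightarrow> bool \<Rightarrow> graph" where
  "set_edge x p q b = (if b then insert {p, q} x else x - {{p, q}})"

lemma set_edge_iff: "e \<in> set_edge x p q b \<longleftrightarrow> (if e = {p, q} then b else e \<in> x)"
  by (simp add: set_edge_def)

lemma set_edge_graphs:
  "x \<in> graphs n \<Longrightarrow> p < n \<Longrightarrow> q < n \<Longrightarrow> p \<noteq> q \<Longrightarrow> set_edge x p q b \<in> graphs n"
  by (auto simp: set_edge_def graphs_def)

lemma graphs_eqI:
  assumes "x \<in> graphs n" "y \<in> graphs n"
    and "\<And>i j. i < n \<Longrightarrow> j < n \<Longrightarrow> i \<noteq> j \<Longrightarrow> {i, j} \<in> x \<longleftrightarrow> {i, j} \<in> y"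
  shows "x = y"
proof -
  have "e \<in> x \<longleftrightarrow> e \<in> y" if "e \<in> nsets {..<n} 2" for e
    using that assms(3) by (auto simp: nsets_2_eq)
  then show ?thesis using assms(1,2) unfolding graphs_def by blast
qed

text \<open>For \<open>Suc v < n\<close> this says that transposing \<open>v\<close> and
  \<open>Suc v\<close> is an automorphism of \<open>x\<close>. The edge between the two is
  unconstrained, so true and false twins both count.\<close>

definition twins :: "nat \<Rightarrow> graph \<Rightarrow> nat \<Rightarrow> bool" where
  "twins n x v \<longleftrightarrow> (\<forall>w<n. w \<noteq> v \<longrightarrow> w \<noteq> Suc v \<longrightarrow> ({v, w} \<in> x \<longleftrightarrow> {Suc v, w} \<in> x))"

definition swp :: "nat \<Rightarrow> nat \<Rightarrow> nat" where
  "swp v i = (if i = v then Suc v else if i = Suc v then v else i)"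

text \<open>Swaps and toggles proceed edge by edge in the order in which the program writes to
  memory, so that loop invariants can name the intermediate graphs.\<close>

fun swap_upto :: "graph \<Rightarrow> nat \<Rightarrow> nat \<Rightarrow> graph" where
  "swap_upto x v 0 = x"
| "swap_upto x v (Suc w) = (let y = swap_upto x v w in
     if w = v \<or> w = Suc v then y
     else set_edge (set_edge y v w ({Suc v, w} \<in> y)) (Suc v) w ({v, w} \<in> y))"

fun toggle_upto :: "graph \<Rightarrow> nat \<Rightarrow> nat \<Rightarrow> nat \<Rightarrow> graph" where
  "toggle_upto x a v 0 = x"
| "toggle_upto x a v (Suc i) = (let y = toggle_upto x a v i in set_edge y (a + i) v ({a + i, v} \<notin> y))"

lemma swap_upto_graphs:
  "x \<in> graphs n \<Longrightarrow> Suc v < n \<Longrightarrow> w \<le> n \<Longrightarrow> swap_upto x v w \<in> graphs n"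
  by (induction w) (auto simp: Let_def intro!: set_edge_graphs)

lemma toggle_upto_graphs:
  "x \<in> graphs n \<Longrightarrow> v < n \<Longrightarrow> a + K \<le> n \<Longrightarrow> v \<notin> {a..<a + K} \<Longrightarrow> i \<le> K \<Longrightarrow> toggle_upto x a v i \<in> graphs n"
  by (induction i) (auto simp: Let_def intro!: set_edge_graphs)

text \<open>Halfway through, the graph is in general no relabelling of \<open>x\<close>: an endpoint
  is moved only if the opposite endpoint has already been visited. At \<open>w = n\<close> the
  conditions disappear, since \<open>swp v\<close> fixes vertices outside the pair and maps the pair
  to itself.\<close>

lemma swap_upto_iff:
  "i \<noteq> j \<Longrightarrow> {i, j} \<in> swap_upto x v w \<longleftrightarrow>
    {if j < w \<and> j \<notin> {v, Suc v} then swp v i else i,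
     if i < w \<and> i \<notin> {v, Suc v} then swp v j else j} \<in> x"
proof (induction w arbitrary: i j)
  case (Suc w)
  show ?case
  proof (cases "w = v \<or> w = Suc v")
    case True
    then show ?thesis using Suc.IH[OF Suc.prems] by (auto simp: less_Suc_eq)
  next
    case False
    then show ?thesis using Suc.IH Suc.prems
      by (auto simp: Let_def set_edge_iff doubleton_eq_iff less_Suc_eq swp_def insert_commute)
  qed
qed simp

lemma swap_upto_full_iff:
  assumes "i < n" "j < n" "i \<noteq> j"
  shows "{i, j} \<in> swap_upto x v n \<longleftrightarrow> {swp v i, swp v j} \<in> x"
proof -
  have "i \<in> {v, Suc v} \<and> j \<in> {v, Suc v} \<or> i \<notin> {v, Suc v} \<or> j \<notin> {v, Suc v}" by blast
  then show ?thesis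
    using assms by (subst swap_upto_iff) (auto simp: swp_def insert_commute)
qed

lemma toggle_upto_iff:
  assumes "v \<notin> {a..<a + K}"
  shows "i \<le> K \<Longrightarrow> p \<noteq> q \<Longrightarrow> {p, q} \<in> toggle_upto x a v i \<longleftrightarrow>
    (({p, q} \<in> x) \<noteq> (q = v \<and> p \<in> {a..<a + i} \<or> p = v \<and> q \<in> {a..<a + i}))"
proof (induction i)
  case (Suc i)
  then show ?case using assms
    by (auto simp: Let_def set_edge_iff doubleton_eq_iff less_Suc_eq insert_commute[of v "a + i" "{}"])
qed simp

subsection \<open>Homogeneous sets do not contribute to the parity\<close>

text \<open>A module in the sense of modular decomposition that induces a clique or an independent
  set; for \<open>U\<close> inside the vertex set, every permutation of \<open>U\<close> is then an
  automorphism.\<close>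

definition homogeneous :: "nat \<Rightarrow> nat set \<Rightarrow> graph \<Rightarrow> bool" where
  "homogeneous n U x \<longleftrightarrow>
     (\<forall>w<n. w \<notin> U \<longrightarrow> (\<forall>u\<in>U. \<forall>u'\<in>U. {u, w} \<in> x \<longleftrightarrow> {u', w} \<in> x)) \<and>
     (\<forall>u\<in>U. \<forall>u'\<in>U. \<forall>v\<in>U. \<forall>v'\<in>U. u \<noteq> u' \<longrightarrow> v \<noteq> v' \<longrightarrow> ({u, u'} \<in> x \<longleftrightarrow> {v, v'} \<in> x))"

text \<open>By absorption \<open>2 ^ k\<close> divides \<open>s * (2 ^ k choose s)\<close>; an odd
  binomial would be coprime to \<open>2 ^ k\<close> and force \<open>2 ^ k dvd s\<close>.\<close>

lemma even_power2_choose: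
  assumes "0 < s" "s < 2 ^ k"
  shows "even ((2::nat) ^ k choose s)"
proof (rule ccontr)
  assume odd: "odd ((2::nat) ^ k choose s)"
  have "s * (2 ^ k choose s) = 2 ^ k * ((2 ^ k - 1) choose (s - 1))"
    using assms times_binomial_minus1_eq[of s "2 ^ k"] by simp
  then have "2 ^ k dvd s * (2 ^ k choose s)" by simp
  moreover have "coprime (2 ^ k) (2 ^ k choose s)" using odd by simp
  ultimately have "2 ^ k dvd s" by (simp add: coprime_dvd_mult_left_iff)
  then show False using assms by (auto dest: dvd_imp_le)
qed

text \<open>Only the size of \<open>A\<close> matters: the edges from a vertex of \<open>D\<close>
  to \<open>U\<close> are all present or all absent, and so are the edges inside \<open>U\<close>. A
  nonempty \<open>A\<close> settles the former, two points of \<open>A\<close> the latter.\<close>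

lemma homogeneous_clique_exchange:
  assumes U: "homogeneous n U x" and D: "D \<subseteq> {..<n} - U" and A: "A \<subseteq> U" "A' \<subseteq> U"
    and card: "card A = card A'" "0 < card A" and cl: "clique (D \<union> A) x"
  shows "clique (D \<union> A') x"
proof -
  have cl': "{v, w} \<in> x" if "v \<in> D \<union> A" "w \<in> D \<union> A" "v \<noteq> w" for v w
    using cl that by (auto simp: clique_def)
  have DA: "{w, v} \<in> x" if v: "v \<in> D" and w: "w \<in> A'" for v w
  proof -
    obtain u where u: "u \<in> A" using card by (metis card.empty ex_in_conv less_irrefl)
    then have "{u, v} \<in> x" using cl'[of u v] v D A by auto
    moreover have "v < n" "v \<notin> U" "u \<in> U" "w \<in> U" using v D A u w by auto
    ultimately show ?thesis using U unfolding homogeneous_def by blast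
  qed
  have DA': "{v, w} \<in> x" if "v \<in> D" "w \<in> A'" for v w
    using DA[OF that] by (simp add: insert_commute)
  have AA: "{v, w} \<in> x" if v: "v \<in> A'" and w: "w \<in> A'" and vw: "v \<noteq> w" for v w
  proof -
    have fin: "finite A'" using card by (metis card.infinite less_irrefl)
    have "card {v, w} \<le> card A'" using v w fin by (intro card_mono) auto
    then have "2 \<le> card A" using vw card by simp
    then obtain u u' where u: "u \<in> A" "u' \<in> A" "u \<noteq> u'"
      by (metis card_2_iff' ex_card subsetD)
    then have "{u, u'} \<in> x" using cl' by blast
    then show ?thesis using U u v w vw A unfolding homogeneous_def by blast
  qed
  show ?thesis
    unfolding clique_def using cl' DA AA DA' by blast
qed

text \<open>Cliques that meet \<open>U\<close> are grouped by their part \<open>D\<close> outside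
  \<open>U\<close>. By the exchange property a nonempty group consists of all
  \<open>D \<union> A\<close> with \<open>A\<close> ranging over the subsets of \<open>U\<close> of
  one size \<open>s\<close>, an even number of cliques.\<close>

lemma clique_parity_homogeneous:
  assumes U: "homogeneous n U x" "U \<subseteq> {..<n}" "card U = 2 ^ k"
  shows "clique_parity k n x \<longleftrightarrow> odd (card {C \<in> nsets ({..<n} - U) k. clique C x})"
proof -
  define X where "X = {C \<in> nsets {..<n} k. clique C x \<and> C \<inter> U \<noteq> {}}"
  define fib where "fib D = {C \<in> X. C - U = D}" for D
  have fin: "finite (nsets {..<n} k)" by (simp add: finite_imp_finite_nsets)
  have finU: "finite U" using U(2) finite_subset by blast
  have finX: "finite X" using fin by (simp add: X_def)
  have "even (card (fib D))" for D
  proof (cases "fib D = {}")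
    case False
    then obtain C where C: "C \<in> nsets {..<n} k" "clique C x" "C \<inter> U \<noteq> {}" "C - U = D"
      by (auto simp: fib_def X_def)
    define s where "s = card (C \<inter> U)"
    have finC: "finite C" using C(1) by (simp add: nsets_def)
    have D: "D \<subseteq> {..<n} - U" using C by (auto simp: nsets_def)
    have finD: "finite D" using D finite_subset by blast
    have s0: "0 < s" using C(3) finC by (simp add: s_def card_gt_0_iff)
    have CU: "C = D \<union> (C \<inter> U)" using C(4) by blast
    have k: "card D + s = k"
    proof -
      have "D \<inter> (C \<inter> U) = {}" using D by blast
      then have "card C = card D + s"
        using card_Un_disjoint[of D "C \<inter> U"] finC finD CU by (simp add: s_def)
      then show ?thesis using C(1) by (simp add: nsets_def)
    qed
    have "fib D = (\<lambda>A. D \<union> A) ` nsets U s"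
    proof (intro equalityI subsetI)
      fix B assume "B \<in> fib D"
      then have B: "B \<in> nsets {..<n} k" "B - U = D" by (auto simp: fib_def X_def)
      have "B = D \<union> (B \<inter> U)" using B by blast
      moreover have "finite B" using B(1) by (simp add: nsets_def)
      moreover have "D \<inter> (B \<inter> U) = {}" using D by blast
      ultimately have "card B = card D + card (B \<inter> U)"
        using card_Un_disjoint[of D "B \<inter> U"] finD by simp
      then have "card D + card (B \<inter> U) = k" using B(1) by (simp add: nsets_def)
      then have "B \<inter> U \<in> nsets U s" using k \<open>finite B\<close> by (auto simp: nsets_def)
      then show "B \<in> (\<lambda>A. D \<union> A) ` nsets U s" using \<open>B = D \<union> (B \<inter> U)\<close> by blast
    next
      fix B assume "B \<in> (\<lambda>A. D \<union> A) ` nsets U s"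
      then obtain A where A: "B = D \<union> A" "A \<subseteq> U" "finite A" "card A = s" by (auto simp: nsets_def)
      have "clique B x"
        unfolding A(1) using homogeneous_clique_exchange[OF U(1) D, of "C \<inter> U" A] A C(2) CU s0
        by (simp add: s_def)
      moreover have "card B = k" using A D finD k by (subst A(1), subst card_Un_disjoint) auto
      moreover have "A \<noteq> {}" using A s0 by auto
      ultimately show "B \<in> fib D" using A D U(2) finD by (auto simp: fib_def X_def nsets_def)
    qed
    moreover have "inj_on (\<lambda>A. D \<union> A) (nsets U s)"
    proof (rule inj_onI)
      fix A B assume "A \<in> nsets U s" "B \<in> nsets U s" "D \<union> A = D \<union> B"
      moreover then have "(D \<union> A) \<inter> U = A" "(D \<union> B) \<inter> U = B" using D by (auto simp: nsets_def)
      ultimately show "A = B" by metis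
    qed
    ultimately have "card (fib D) = 2 ^ k choose s"
      using U(3) finU by (simp add: card_image)
    moreover have "s < 2 ^ k" using k less_exp[of k] by linarith
    ultimately show ?thesis using even_power2_choose[OF s0] by simp
  qed simp
  moreover have "card X = (\<Sum>D\<in>(\<lambda>C. C - U) ` X. card (fib D))"
    unfolding fib_def using sum.image_gen[OF finX, of "\<lambda>_. 1::nat" "\<lambda>C. C - U"] by simp
  ultimately have "even (card X)" by (simp add: dvd_sum)
  moreover have "{C \<in> nsets {..<n} k. clique C x} = {C \<in> nsets ({..<n} - U) k. clique C x} \<union> X"
    by (auto simp: X_def nsets_def)
  moreover have "{C \<in> nsets ({..<n} - U) k. clique C x} \<inter> X = {}"
    by (auto simp: X_def nsets_def)
  moreover have "finite {C \<in> nsets ({..<n} - U) k. clique C x}"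
    by (simp add: finite_imp_finite_nsets)
  ultimately show ?thesis
    unfolding clique_parity_def using finX by (simp add: card_Un_disjoint)
qed

text \<open>Consecutive twin relations chain up, but \<open>twins\<close> is silent about the edge
  joining the two twins. Neighbouring inner edges are compared through a triangle:
  \<open>{u, Suc u}\<close> with \<open>{u, Suc (Suc u)}\<close>, and this with
  \<open>{Suc u, Suc (Suc u)}\<close>.\<close>

lemma homogeneous_if_twins:
  assumes len: "a + 3 \<le> b" and bn: "b \<le> n" and tw: "\<And>v. a \<le> v \<Longrightarrow> Suc v < b \<Longrightarrow> twins n x v"
  shows "homogeneous n {a..<b} x"
proof -
  have out: "{u, w} \<in> x \<longleftrightarrow> {a, w} \<in> x" if "w < n" "w \<notin> {a..<b}" "u \<in> {a..<b}" for u w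
  proof -
    have "a \<le> u" "u < b" using that by auto
    then show ?thesis
    proof (induction u rule: dec_induct)
      case (step u)
      then show ?case using tw[of u] that unfolding twins_def by auto
    qed simp
  qed
  have consec: "{u, Suc u} \<in> x \<longleftrightarrow> {a, Suc a} \<in> x" if "a \<le> u" "Suc u < b" for u
    using that
  proof (induction u rule: dec_induct)
    case (step u)
    have "{Suc u, u} \<in> x \<longleftrightarrow> {Suc (Suc u), u} \<in> x"
      using tw[of "Suc u"] step(1,2,4) bn unfolding twins_def by simp
    also have "\<dots> \<longleftrightarrow> {u, Suc (Suc u)} \<in> x" by (simp only: insert_commute)
    also have "\<dots> \<longleftrightarrow> {Suc u, Suc (Suc u)} \<in> x"
      using tw[of u] step(1,2,4) bn unfolding twins_def by simp
    finally show ?case using step(3,4) by (simp add: insert_commute[of "Suc u" u])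
  qed simp
  have gap: "{u, w} \<in> x \<longleftrightarrow> {a, Suc a} \<in> x" if "a \<le> u" "Suc u \<le> w" "w < b" for u w
    using that(2,3)
  proof (induction w rule: dec_induct)
    case base
    show ?case by (rule consec) (use that base in auto)
  next
    case (step w)
    have "{w, u} \<in> x \<longleftrightarrow> {Suc w, u} \<in> x"
      using tw[of w] step(1,2,4) that bn unfolding twins_def by simp
    then show ?case using step(3,4) by (simp add: insert_commute[of _ u])
  qed
  have ins: "{u, w} \<in> x \<longleftrightarrow> {a, Suc a} \<in> x" if "u \<in> {a..<b}" "w \<in> {a..<b}" "u \<noteq> w" for u w
  proof (cases "u < w")
    case True
    then show ?thesis using gap[of u w] that by simp
  next
    case False
    then show ?thesis using gap[of w u] that by (simp add: insert_commute)
  qed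
  show ?thesis
    unfolding homogeneous_def
  proof (intro conjI allI impI ballI)
    fix w u u' assume "w < n" "w \<notin> {a..<b}" "u \<in> {a..<b}" "u' \<in> {a..<b}"
    then show "{u, w} \<in> x \<longleftrightarrow> {u', w} \<in> x" using out[of w u] out[of w u'] by simp
  next
    fix u u' v v' assume "u \<in> {a..<b}" "u' \<in> {a..<b}" "v \<in> {a..<b}" "v' \<in> {a..<b}" "u \<noteq> u'" "v \<noteq> v'"
    then show "{u, u'} \<in> x \<longleftrightarrow> {v, v'} \<in> x" using ins[of u u'] ins[of v v'] by simp
  qed
qed


subsection \<open>Scanning for twins and shaking the graph\<close>

fun run_len :: "nat \<Rightarrow> graph \<Rightarrow> nat \<Rightarrow> nat" where
  "run_len n x 0 = 0"
| "run_len n x (Suc v) = (if twins n x v then Suc (run_len n x v) else 0)"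

text \<open>\<open>sel n x (Suc v)\<close> says that the pair \<open>v, v + 1\<close> is selected; selected pairs are disjoint.\<close>

fun sel :: "nat \<Rightarrow> graph \<Rightarrow> nat \<Rightarrow> bool" where
  "sel n x 0 = False"
| "sel n x (Suc v) = (\<not> twins n x v \<and> \<not> sel n x v)"

text \<open>The value \<open>0\<close> encodes that no block has been met; otherwise it is the
  exclusive end \<open>b\<close> of the block \<open>{b - K..<b}\<close> found last.
  \<open>K\<close> vertices span \<open>K - 1\<close> neighbouring pairs, whence the
  threshold.\<close>

fun block_end :: "nat \<Rightarrow> nat \<Rightarrow> graph \<Rightarrow> nat \<Rightarrow> nat" where
  "block_end n K x 0 = 0"
| "block_end n K x (Suc v) =
     (if K - 1 \<le> run_len n x (Suc v) then Suc (Suc v) else block_end n K x v)"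

definition picked :: "nat \<Rightarrow> graph \<Rightarrow> nat \<Rightarrow> bool" where
  "picked n x v \<longleftrightarrow> Suc v < n \<and> sel n x (Suc v)"

text \<open>Block and selected pairs are read off the start graph \<open>x\<close> and not off the
  current graph \<open>y\<close>, because the program scans once before it shakes.\<close>

definition act :: "nat \<Rightarrow> nat \<Rightarrow> graph \<Rightarrow> nat \<Rightarrow> graph \<Rightarrow> graph" where
  "act n K x v y =
     (let b = block_end n K x (n - 1) in
      if b \<noteq> 0 then (if v \<in> {b - K..<b} then y else toggle_upto y (b - K) v K)
      else if picked n x v then swap_upto y v n else y)"

fun walk :: "nat \<Rightarrow> nat \<Rightarrow> graph \<Rightarrow> bool list \<Rightarrow> nat \<Rightarrow> graph" where
  "walk n K x \<omega> 0 = x"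
| "walk n K x \<omega> (Suc v) =
     (if \<omega> ! v then act n K x v (walk n K x \<omega> v) else walk n K x \<omega> v)"

definition shake :: "nat \<Rightarrow> nat \<Rightarrow> graph \<Rightarrow> bool list \<Rightarrow> graph" where
  "shake n K x \<omega> = walk n K x \<omega> n"

section \<open>Twin runs, blocks and the number of selected pairs\<close>

lemma run_len_le: "run_len n x v \<le> v"
  by (induction v) auto

lemma run_len_twins: "v - run_len n x v \<le> u \<Longrightarrow> u < v \<Longrightarrow> twins n x u"
proof (induction v)
  case (Suc v)
  then show ?case using run_len_le[of n x v] by (cases "u = v") (auto split: if_splits)
qed simp

lemma run_len_ge: "(\<And>u. a \<le> u \<Longrightarrow> u < a + j \<Longrightarrow> twins n x u) \<Longrightarrow> j \<le> run_len n x (a + j)"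
  by (induction j) auto

lemma block_end_twins:
  assumes "block_end n K x v \<noteq> 0" "2 \<le> K"
  shows "K \<le> block_end n K x v" "block_end n K x v \<le> Suc v"
    and "\<And>u. block_end n K x v - K \<le> u \<Longrightarrow> Suc u < block_end n K x v \<Longrightarrow> twins n x u"
  using assms
proof (atomize (full), induction v)
  case (Suc v)
  show ?case
  proof (cases "K - 1 \<le> run_len n x (Suc v)")
    case True
    then show ?thesis
      using Suc.prems run_len_le[of n x "Suc v"] run_len_twins[of "Suc v" n x]
      by (auto simp del: run_len.simps)
  next
    case False
    then show ?thesis using Suc by auto
  qed
qed simp

lemma block_end_zero:
  assumes "block_end n K x v = 0" "u + (K - 1) \<le> v" "2 \<le> K"
  shows "\<exists>w\<ge>u. w < u + (K - 1) \<and> \<not> twins n x w"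
proof (rule ccontr)
  assume "\<not> ?thesis"
  then have "K - 1 \<le> run_len n x (u + (K - 1))" by (intro run_len_ge) auto
  moreover have "run_len n x w < K - 1" if "w \<noteq> 0" "w \<le> v" for w
    using assms(1) that
  proof (induction v)
    case (Suc v)
    then show ?case by (cases "w = Suc v") (auto simp del: run_len.simps split: if_splits)
  qed simp
  from this[of "u + (K - 1)"] have "run_len n x (u + (K - 1)) < K - 1" using assms(2,3) by simp
  ultimately show False by linarith
qed

text \<open>Each window of \<open>K\<close> indices holds a selected pair: at a non-twin index
  \<open>w\<close> the greedy selection either takes \<open>w\<close> or skips it because
  \<open>w - 1\<close> was taken.\<close>

lemma card_picked:
  assumes "block_end n K x (n - 1) = 0" "2 \<le> K"
  shows "(n - 1) div K \<le> card {v. picked n x v}"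
proof -
  have "\<exists>v. picked n x v \<and> v div K = b" if b: "b < (n - 1) div K" for b
  proof -
    have "Suc b * K \<le> (n - 1) div K * K" using b by (intro mult_right_mono) auto
    also have "\<dots> \<le> n - 1" by simp
    finally have bn: "b * K + K \<le> n - 1" by simp
    \<comment> \<open>Searching from one past \<open>b * K\<close> keeps the alternative index
      \<open>w - 1\<close> in the same window.\<close>
    then have "Suc (b * K) + (K - 1) \<le> n - 1" using assms(2) by linarith
    from block_end_zero[OF assms(1) this assms(2)] obtain w where
      w: "Suc (b * K) \<le> w" "w < Suc (b * K) + (K - 1)" "\<not> twins n x w" by blast
    obtain w' where w': "w = Suc w'" using w(1) by (cases w) auto
    have *: "u div K = b" if "b * K \<le> u" "u < b * K + K" for u
      using that by (simp add: div_nat_eqI mult.commute add.commute)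
    show ?thesis
    proof (cases "sel n x w")
      case True
      then show ?thesis using w w' bn *[of w'] by (intro exI[of _ w']) (auto simp: picked_def simp del: sel.simps)
    next
      case False
      then show ?thesis using w bn *[of w] by (intro exI[of _ w]) (auto simp: picked_def)
    qed
  qed
  then have "{..<(n - 1) div K} \<subseteq> (\<lambda>v. v div K) ` {v. picked n x v}" by (auto simp: image_iff)
  moreover have "finite {v. picked n x v}"
    by (rule finite_subset[of _ "{..<n}"]) (auto simp: picked_def)
  ultimately show ?thesis by (metis card_lessThan surj_card_le)
qed

lemma picked_disjoint: "picked n x v \<Longrightarrow> \<not> picked n x (Suc v)"
  by (simp add: picked_def)

lemma picked_not_twins: "picked n x v \<Longrightarrow> \<not> twins n x v"
  by (simp add: picked_def)

lemma act_graphs: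
  assumes "y \<in> graphs n" "v < n" "2 \<le> K"
  shows "act n K x v y \<in> graphs n"
proof -
  let ?b = "block_end n K x (n - 1)"
  have "toggle_upto y (?b - K) v K \<in> graphs n" if "?b \<noteq> 0" "v \<notin> {?b - K..<?b}"
    using toggle_upto_graphs[of y n v "?b - K" K K] block_end_twins(1,2)[OF that(1) assms(3)] assms that
    by simp
  moreover have "swap_upto y v n \<in> graphs n" if "picked n x v"
    using swap_upto_graphs[of y n v n] assms that by (simp add: picked_def)
  ultimately show ?thesis using assms by (simp add: act_def Let_def)
qed

lemma walk_graphs: "x \<in> graphs n \<Longrightarrow> 2 \<le> K \<Longrightarrow> v \<le> n \<Longrightarrow> walk n K x \<omega> v \<in> graphs n"
  by (induction v) (auto intro: act_graphs)

lemma shake_graphs: "x \<in> graphs n \<Longrightarrow> 2 \<le> K \<Longrightarrow> shake n K x \<omega> \<in> graphs n"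
  by (simp add: shake_def walk_graphs)

section \<open>Closed forms of the walk and invariance of the parity\<close>

lemma clique_parity_swap:
  assumes "y \<in> graphs n" "Suc v < n"
  shows "clique_parity k n (swap_upto y v n) = clique_parity k n y"
proof -
  have bij: "bij_betw (swp v) {..<n} {..<n}"
    by (rule bij_betwI[of _ _ _ "swp v"]) (use assms in \<open>auto simp: swp_def\<close>)
  have inv: "swp v (swp v i) = i" for i by (auto simp: swp_def)
  have "(`) (swp v) ` y \<in> graphs n"
  proof -
    have "swp v ` e \<in> nsets {..<n} 2" if "e \<in> y" for e
    proof -
      have "e \<in> nsets {..<n} 2" using assms that by (auto simp: graphs_def)
      then obtain i j where "e = {i, j}" "i < n" "j < n" "i \<noteq> j" by (auto simp: nsets_2_eq)
      moreover have "swp v i \<noteq> swp v j" using \<open>i \<noteq> j\<close> inv by metis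
      ultimately show ?thesis using bij by (auto simp: bij_betw_def)
    qed
    then show ?thesis by (auto simp: graphs_def)
  qed
  moreover have "{i, j} \<in> (`) (swp v) ` y \<longleftrightarrow> {swp v i, swp v j} \<in> y" for i j
  proof
    assume "{i, j} \<in> (`) (swp v) ` y"
    then obtain e where "e \<in> y" "{i, j} = swp v ` e" by blast
    moreover have "swp v ` swp v ` e = e" by (simp add: image_image inv)
    ultimately have "swp v ` {i, j} \<in> y" by metis
    then show "{swp v i, swp v j} \<in> y" by simp
  next
    assume "{swp v i, swp v j} \<in> y"
    then show "{i, j} \<in> (`) (swp v) ` y"
      by (intro image_eqI[of _ _ "{swp v i, swp v j}"]) (auto simp: inv)
  qed
  ultimately have "swap_upto y v n = (`) (swp v) ` y"
    using assms by (intro graphs_eqI[of _ n] swap_upto_graphs) (auto simp: swap_upto_full_iff)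
  then show ?thesis using iso_invariant_clique_parity[of n k] assms(1) bij
    by (auto simp: iso_invariant_def)
qed

text \<open>Every outside vertex owns its edges to the block, so the steps do not interfere and each
  coin flips its own edges once.\<close>

lemma walk_toggle_iff:
  assumes b: "b = block_end n K x (n - 1)" "b \<noteq> 0" and K: "2 \<le> K" and "i \<noteq> j"
  shows "v \<le> n \<Longrightarrow> {i, j} \<in> walk n K x \<omega> v \<longleftrightarrow>
    (({i, j} \<in> x) \<noteq> (i \<in> {b - K..<b} \<and> j \<notin> {b - K..<b} \<and> j < v \<and> \<omega> ! j \<or>
                     j \<in> {b - K..<b} \<and> i \<notin> {b - K..<b} \<and> i < v \<and> \<omega> ! i))"
proof (induction v)
  case (Suc v)
  have Kb: "K \<le> b" using block_end_twins(1)[OF _ K] b by simp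
  have v: "v < n" using Suc.prems by simp
  have IH: "{i, j} \<in> walk n K x \<omega> v \<longleftrightarrow>
    (({i, j} \<in> x) \<noteq> (i \<in> {b - K..<b} \<and> j \<notin> {b - K..<b} \<and> j < v \<and> \<omega> ! j \<or>
                     j \<in> {b - K..<b} \<and> i \<notin> {b - K..<b} \<and> i < v \<and> \<omega> ! i))"
    using Suc by simp
  have act: "act n K x v y = (if v \<in> {b - K..<b} then y else toggle_upto y (b - K) v K)" for y
    using b by (auto simp: act_def Let_def)
  show ?case
  proof (cases "\<omega> ! v \<and> v \<notin> {b - K..<b}")
    case True
    then have "{i, j} \<in> walk n K x \<omega> (Suc v) \<longleftrightarrow>
      (({i, j} \<in> walk n K x \<omega> v) \<noteq> (j = v \<and> i \<in> {b - K..<b} \<or> i = v \<and> j \<in> {b - K..<b}))"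
      using toggle_upto_iff[of v "b - K" K K i j "walk n K x \<omega> v"] Kb assms(4)
      by (simp only: walk.simps act) simp
    then show ?thesis using IH True assms(4) by (simp only: less_Suc_eq) blast
  next
    case False
    then have "walk n K x \<omega> (Suc v) = walk n K x \<omega> v" by (auto simp: act)
    then show ?thesis using IH False by (simp only: less_Suc_eq) blast
  qed
qed simp

text \<open>The product of the transpositions of those selected pairs below \<open>v\<close> whose
  coin came up. Disjointness of the pairs makes it an involution.\<close>

definition shift :: "nat \<Rightarrow> graph \<Rightarrow> bool list \<Rightarrow> nat \<Rightarrow> nat \<Rightarrow> nat" where
  "shift n x \<omega> v i =
     (if picked n x i \<and> i < v \<and> \<omega> ! i then Suc i
      else if 0 < i \<and> picked n x (i - 1) \<and> i - 1 < v \<and> \<omega> ! (i - 1) then i - 1 else i)"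

lemma shift_less: "i < n \<Longrightarrow> shift n x \<omega> v i < n"
  by (auto simp: shift_def picked_def)

lemma shift_shift: "shift n x \<omega> v (shift n x \<omega> v i) = i"
  using picked_disjoint[of n x i] picked_disjoint[of n x "i - 2"]
  by (auto simp: shift_def numeral_2_eq_2)

lemma walk_shift_iff:
  assumes b: "block_end n K x (n - 1) = 0" and ij: "i < n" "j < n" "i \<noteq> j"
  shows "v \<le> n \<Longrightarrow> {i, j} \<in> walk n K x \<omega> v \<longleftrightarrow> {shift n x \<omega> v i, shift n x \<omega> v j} \<in> x"
  using ij
proof (induction v arbitrary: i j)
  case 0
  then show ?case by (simp add: shift_def)
next
  case (Suc v)
  show ?case
  proof (cases "\<omega> ! v \<and> picked n x v")
    case True
    then have p: "picked n x v" "Suc v < n" by (auto simp: picked_def)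
    \<comment> \<open>No earlier swap has touched \<open>v\<close> or \<open>Suc v\<close>, so the
      new transposition may be composed on the inside.\<close>
    have "\<not> (0 < v \<and> picked n x (v - 1))" using p(1) picked_disjoint[of n x "v - 1"] by auto
    then have s: "shift n x \<omega> (Suc v) l = shift n x \<omega> v (swp v l)" for l
      using p(1) picked_disjoint[of n x v] True
      by (auto simp: shift_def swp_def less_Suc_eq)
    have "{i, j} \<in> walk n K x \<omega> (Suc v) \<longleftrightarrow> {swp v i, swp v j} \<in> walk n K x \<omega> v"
      using True b Suc.prems by (simp add: act_def swap_upto_full_iff)
    also have "\<dots> \<longleftrightarrow> {shift n x \<omega> v (swp v i), shift n x \<omega> v (swp v j)} \<in> x"
      using Suc.prems p by (intro Suc.IH) (auto simp: swp_def)
    finally show ?thesis by (simp add: s)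
  next
    case False
    then have s: "shift n x \<omega> (Suc v) l = shift n x \<omega> v l" for l
      by (auto simp: shift_def less_Suc_eq)
    show ?thesis using Suc False b by (auto simp: s act_def)
  qed
qed

text \<open>Swaps are isomorphisms. In the block case toggling hits the block as a whole and keeps
  it homogeneous, so both parities reduce to counting cliques off the block, where nothing has
  changed.\<close>

lemma clique_parity_walk:
  assumes "x \<in> graphs n" "3 \<le> (2::nat) ^ k"
  shows "v \<le> n \<Longrightarrow> clique_parity k n (walk n (2 ^ k) x \<omega> v) = clique_parity k n x"
proof (cases "block_end n (2 ^ k) x (n - 1) = 0")
  case True
  then show "v \<le> n \<Longrightarrow> ?thesis"
  proof (induction v)
    case (Suc v)
    have "walk n (2 ^ k) x \<omega> v \<in> graphs n" using assms Suc.prems by (intro walk_graphs) auto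
    then show ?case using Suc clique_parity_swap[of _ n v k] by (auto simp: act_def picked_def)
  qed simp
next
  case False
  define b where "b = block_end n (2 ^ k) x (n - 1)"
  let ?y = "walk n (2 ^ k) x \<omega> v"
  let ?U = "{b - 2 ^ k..<b}"
  have b0: "b \<noteq> 0" using False by (simp add: b_def)
  have K: "2 \<le> (2::nat) ^ k" using assms by simp
  note bt = block_end_twins[OF False K, folded b_def]
  have bn: "b \<le> n" using bt(2) b0 bt(1) K by linarith
  assume v: "v \<le> n"
  note iff = walk_toggle_iff[OF b_def b0 K _ v]
  have hx: "homogeneous n ?U x"
    using bt bn assms(2) by (intro homogeneous_if_twins) auto
  have inU: "{i, j} \<in> ?y \<longleftrightarrow> {i, j} \<in> x" if "i \<in> ?U \<longleftrightarrow> j \<in> ?U" "i \<noteq> j" for i j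
    using iff[of i j] that by auto
  have out: "{u, w} \<in> ?y \<longleftrightarrow> ({u, w} \<in> x) \<noteq> (w < v \<and> \<omega> ! w)" if "u \<in> ?U" "w \<notin> ?U" for u w
    using iff[of u w] that by auto
  have hy: "homogeneous n ?U ?y"
    unfolding homogeneous_def
  proof (intro conjI allI impI ballI)
    fix w u u' assume "w < n" "w \<notin> ?U" "u \<in> ?U" "u' \<in> ?U"
    then show "{u, w} \<in> ?y \<longleftrightarrow> {u', w} \<in> ?y"
      using hx out[of u w] out[of u' w] unfolding homogeneous_def by blast
  next
    fix u u' w w' assume "u \<in> ?U" "u' \<in> ?U" "w \<in> ?U" "w' \<in> ?U" "u \<noteq> u'" "w \<noteq> w'"
    then show "{u, u'} \<in> ?y \<longleftrightarrow> {w, w'} \<in> ?y"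
      using hx inU[of u u'] inU[of w w'] unfolding homogeneous_def by blast
  qed
  have U: "?U \<subseteq> {..<n}" "card ?U = 2 ^ k" using bn bt(1) by auto
  have "clique C ?y \<longleftrightarrow> clique C x" if "C \<subseteq> {..<n} - ?U" for C
    unfolding clique_def using inU that by blast
  then have "{C \<in> nsets ({..<n} - ?U) k. clique C ?y} = {C \<in> nsets ({..<n} - ?U) k. clique C x}"
    by (auto simp: nsets_def)
  then show ?thesis
    using clique_parity_homogeneous[OF hx U] clique_parity_homogeneous[OF hy U] by simp
qed

lemma clique_parity_shake:
  "x \<in> graphs n \<Longrightarrow> 3 \<le> (2::nat) ^ k \<Longrightarrow> clique_parity k n (shake n (2 ^ k) x \<omega>) = clique_parity k n x"
  by (simp add: shake_def clique_parity_walk)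

subsection \<open>The shaken graph has high min-entropy\<close>

text \<open>Used with \<open>F\<close> the coin strings that lead to one given graph: it bounds the
  probability of that graph by \<open>2 ^ card J\<close> in the denominator.\<close>

lemma card_determined_off_le:
  assumes F: "F \<subseteq> {w :: bool list. length w = n}" and J: "J \<subseteq> {..<n}"
    and det: "\<And>u w. u \<in> F \<Longrightarrow> w \<in> F \<Longrightarrow> (\<And>i. i < n \<Longrightarrow> i \<notin> J \<Longrightarrow> u ! i = w ! i) \<Longrightarrow> u = w"
  shows "card F \<le> 2 ^ (n - card J)"
proof -
  let ?f = "\<lambda>w :: bool list. {i \<in> {..<n} - J. w ! i}"
  have "inj_on ?f F" by (rule inj_onI, rule det) auto
  then have "card F \<le> card (Pow ({..<n} - J))" by (rule card_inj_on_le) auto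
  also have "\<dots> = 2 ^ (n - card J)"
    using J finite_subset[OF J] by (simp add: card_Pow card_Diff_subset)
  finally show ?thesis .
qed

text \<open>A functional graph is 3-colourable; a largest independent set already witnesses the
  bound on the independence number.\<close>

lemma functional_graph_independent_set:
  assumes "finite A" "\<And>i. i \<in> A \<Longrightarrow> f i \<noteq> i"
  obtains J where "J \<subseteq> A" "card A \<le> 3 * card J" "\<And>i. i \<in> J \<Longrightarrow> f i \<notin> J"
proof -
  define ind where "ind J \<longleftrightarrow> J \<subseteq> A \<and> (\<forall>i\<in>J. f i \<notin> J)" for J
  have "finite (Collect ind)" by (rule finite_subset[of _ "Pow A"]) (use assms in \<open>auto simp: ind_def\<close>)
  moreover have "ind {}" by (simp add: ind_def)
  ultimately obtain J where J: "ind J" "\<And>I. ind I \<Longrightarrow> card I \<le> card J"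
    using Max_in[of "card ` Collect ind"] Max_ge[of "card ` Collect ind"]
    by (smt (verit, best) emptyE finite_imageI imageE image_eqI mem_Collect_eq)
  have fin: "finite J" using J(1) assms(1) by (auto simp: ind_def intro: finite_subset)
  \<comment> \<open>By maximality a vertex outside \<open>J\<close> is an image of one in
    \<open>J\<close> or maps into \<open>J\<close>. The vertices of the second kind form an
    independent set themselves, hence number at most \<open>card J\<close>.\<close>
  define B where "B = {i \<in> A - J. f i \<in> J}"
  have "A \<subseteq> J \<union> f ` J \<union> B"
  proof
    fix i assume i: "i \<in> A"
    show "i \<in> J \<union> f ` J \<union> B"
    proof (rule ccontr)
      assume c: "\<not> ?thesis"
      then have "ind (insert i J)" using i J(1) assms(2) by (auto simp: ind_def B_def)
      from J(2)[OF this] show False using c fin by simp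
    qed
  qed
  moreover have "card B \<le> card J" by (rule J(2)) (auto simp: ind_def B_def)
  moreover have "finite B" using assms(1) by (simp add: B_def)
  ultimately have "card A \<le> card J + card J + card J"
    using card_mono[of "J \<union> f ` J \<union> B" A] card_Un_le[of "J \<union> f ` J" B] card_Un_le[of J "f ` J"]
      card_image_le[OF fin, of f] fin by simp
  then show ?thesis using J(1) by (intro that[of J]) (auto simp: ind_def)
qed

text \<open>Every selected pair has a witness that tells its two vertices apart. On a set \<open>J\<close> of pairs
  none of whose witnesses lie in a pair of \<open>J\<close>, the coins of \<open>J\<close> can be read off the result
  once the other coins are known.\<close>

lemma card_shake_eq_le:
  assumes x: "x \<in> graphs n" and K: "2 \<le> K" "2 * K \<le> n"
  shows "card {w. length w = n \<and> shake n K x w = y} \<le> 2 ^ (n - (n - 1) div K div 3)"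
proof (cases "block_end n K x (n - 1) = 0")
  case True
  define A where "A = {v. picked n x v}"
  have A: "finite A" "A \<subseteq> {..<n}"
    by (rule finite_subset[of _ "{..<n}"]) (auto simp: picked_def A_def)
  define wit where "wit v = (SOME w. w < n \<and> w \<noteq> v \<and> w \<noteq> Suc v \<and> ({v, w} \<in> x \<longleftrightarrow> {Suc v, w} \<notin> x))" for v
  have wit: "wit v < n" "wit v \<noteq> v" "wit v \<noteq> Suc v" "{v, wit v} \<in> x \<longleftrightarrow> {Suc v, wit v} \<notin> x" if "v \<in> A" for v
  proof -
    have "\<exists>w. w < n \<and> w \<noteq> v \<and> w \<noteq> Suc v \<and> ({v, w} \<in> x \<longleftrightarrow> {Suc v, w} \<notin> x)"
      using picked_not_twins[of n x v] that by (auto simp: A_def twins_def)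
    from someI_ex[OF this] show "wit v < n" "wit v \<noteq> v" "wit v \<noteq> Suc v" "{v, wit v} \<in> x \<longleftrightarrow> {Suc v, wit v} \<notin> x"
      unfolding wit_def by blast+
  qed
  \<comment> \<open>Only a selected pair starting at \<open>wit v\<close> or just before it can move
    the witness, and never both are selected; \<open>f v\<close> indexes the one relevant
    coin.\<close>
  define f where "f v = (if picked n x (wit v) then wit v else wit v - 1)" for v
  have "f v \<noteq> v" if "v \<in> A" for v
    using wit[OF that] that picked_disjoint[of n x v] by (auto simp: f_def A_def)
  then obtain J where J: "J \<subseteq> A" "card A \<le> 3 * card J" "\<And>i. i \<in> J \<Longrightarrow> f i \<notin> J"
    using functional_graph_independent_set[OF A(1)] by blast
  have "card {w. length w = n \<and> shake n K x w = y} \<le> 2 ^ (n - card J)"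
  proof (rule card_determined_off_le)
    show "J \<subseteq> {..<n}" using J A by blast
    fix u w assume "u \<in> {w. length w = n \<and> shake n K x w = y}" "w \<in> {w. length w = n \<and> shake n K x w = y}"
      and agree: "\<And>i. i < n \<Longrightarrow> i \<notin> J \<Longrightarrow> u ! i = w ! i"
    then have u: "length u = n" "walk n K x u n = y" and w: "length w = n" "walk n K x w n = y"
      by (auto simp: shake_def)
    have "u ! v = w ! v" if v: "v \<in> J" for v
    proof -
      have vA: "picked n x v" "v \<in> A" using v J by (auto simp: A_def)
      then have Sv: "Suc v < n" by (simp add: picked_def)
      \<comment> \<open>The place of the witness in the shaken graph. Its coin lies outside
        \<open>J\<close>, so both strings agree on \<open>z\<close>. The edge \<open>{v, z}\<close>
        of \<open>y\<close> then reveals the coin of \<open>v\<close>, as it pulls back to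
        \<open>{v, wit v}\<close> or \<open>{Suc v, wit v}\<close>, exactly one of which is in
        \<open>x\<close>.\<close>
      define z where "z = shift n x u n (wit v)"
      have zw: "z = shift n x w n (wit v)"
      proof -
        have "u ! wit v = w ! wit v" if "picked n x (wit v)"
          using J(3)[OF v] wit(1)[OF vA(2)] that by (intro agree) (auto simp: f_def)
        moreover have "u ! (wit v - 1) = w ! (wit v - 1)" if "\<not> picked n x (wit v)"
          using J(3)[OF v] wit(1)[OF vA(2)] that by (intro agree) (auto simp: f_def)
        moreover have "\<not> picked n x (wit v - 1)" if "picked n x (wit v)" "0 < wit v"
          using picked_disjoint[of n x "wit v - 1"] that by auto
        ultimately show ?thesis unfolding z_def shift_def by auto
      qed
      have zn: "z < n" using wit(1)[OF vA(2)] shift_less by (simp add: z_def)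
      have sv: "shift n x t n v = (if t ! v then Suc v else v)" for t
        using vA picked_disjoint[of n x "v - 1"] Sv by (auto simp: shift_def)
      have sz: "shift n x u n z = wit v" "shift n x w n z = wit v"
        by (simp add: z_def shift_shift) (simp add: zw shift_shift)
      have "z \<noteq> v"
        using sz(1) sv[of u] wit(2,3)[OF vA(2)] by (auto split: if_splits)
      then have vz: "v \<noteq> z" by simp
      have "{v, z} \<in> y \<longleftrightarrow> {shift n x u n v, wit v} \<in> x"
        using walk_shift_iff[OF True _ zn vz le_refl, of u] Sv u(2) sz(1) by simp
      moreover have "{v, z} \<in> y \<longleftrightarrow> {shift n x w n v, wit v} \<in> x"
        using walk_shift_iff[OF True _ zn vz le_refl, of w] Sv w(2) sz(2) by simp
      ultimately show ?thesis using wit(4)[OF vA(2)] by (auto simp: sv split: if_splits)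
    qed
    then have "u ! i = w ! i" if "i < n" for i using agree that by blast
    then show "u = w" using u(1) w(1) by (simp add: nth_equalityI)
  qed auto
  also have "\<dots> \<le> 2 ^ (n - (n - 1) div K div 3)"
    using J(2) card_picked[OF True K(1)] by (intro power_increasing) (auto simp: A_def)
  finally show ?thesis .
next
  case False
  define b where "b = block_end n K x (n - 1)"
  note bt = block_end_twins[OF False K(1), folded b_def]
  have b0: "b \<noteq> 0" using False by (simp add: b_def)
  have bn: "b \<le> n" using bt(2) b0 bt(1) K by linarith
  let ?U = "{b - K..<b}"
  note iff = walk_toggle_iff[OF b_def b0 K(1) _ le_refl]
  have "card {w. length w = n \<and> shake n K x w = y} \<le> 2 ^ (n - card ({..<n} - ?U))"
  proof (rule card_determined_off_le)
    fix u w assume "u \<in> {w. length w = n \<and> shake n K x w = y}" "w \<in> {w. length w = n \<and> shake n K x w = y}"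
      and agree: "\<And>i. i < n \<Longrightarrow> i \<notin> {..<n} - ?U \<Longrightarrow> u ! i = w ! i"
    then have u: "length u = n" "walk n K x u n = y" and w: "length w = n" "walk n K x w n = y"
      by (auto simp: shake_def)
    \<comment> \<open>One edge from \<open>v\<close> to the block, here to its first vertex
      \<open>b - K\<close>, shows whether \<open>v\<close> was toggled. Thus all coins outside the
      block can be recovered.\<close>
    have "u ! v = w ! v" if v: "v < n" "v \<notin> ?U" for v
    proof -
      have a: "b - K \<in> ?U" using bt(1) K by auto
      then have "b - K \<noteq> v" using v by blast
      then show ?thesis using iff[of "b - K" v u] iff[of "b - K" v w] u w a v by auto
    qed
    then have "u ! i = w ! i" if "i < n" for i using agree that by blast
    then show "u = w" using u(1) w(1) by (simp add: nth_equalityI)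
  qed auto
  also have "card ({..<n} - ?U) = n - K"
    using bt(1) bn by (subst card_Diff_subset) auto
  also have "2 ^ (n - (n - K)) \<le> (2::nat) ^ (n - (n - 1) div K div 3)"
  proof (rule power_increasing)
    have "(n - 1) div K div 3 \<le> (n - 1) div K" by simp
    also have "\<dots> \<le> (n - 1) div 2" using K(1) by (intro div_le_mono2) auto
    finally have "(n - 1) div K div 3 \<le> n div 2" by linarith
    then show "n - (n - K) \<le> n - (n - 1) div K div 3" using K(2) by linarith
  qed simp
  finally show ?thesis .
qed

subsection \<open>Deviations of a uniformly random set of fixed size\<close>

lemma card_subsets_avoiding:
  assumes "finite G" "T \<subseteq> G"
  shows "card {S. S \<subseteq> G \<and> card S = s \<and> S \<inter> T = {}} = (card G - card T) choose s"
proof -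
  have "{S. S \<subseteq> G \<and> card S = s \<and> S \<inter> T = {}} = {S. S \<subseteq> G - T \<and> card S = s}" by blast
  then show ?thesis
    using n_subsets[of "G - T" s] assms finite_subset[OF assms(2,1)] by (simp add: card_Diff_subset)
qed

text \<open>Negative correlation in sampling without replacement: once \<open>t\<close> points are
  avoided, the next one is avoided with probability \<open>(L - s) / L\<close>, at most the initial
  density \<open>(N - s) / N\<close>. Avoiding a set is thus no likelier than under independent
  sampling.\<close>

lemma binomial_avoid_le:
  assumes "s \<le> N" "t \<le> N"
  shows "real ((N - t) choose s) \<le> (real (N - s) / real N) ^ t * real (N choose s)"
  using assms(2)
proof (induction t)
  case (Suc t)
  define L where "L = N - t"
  have L: "0 < L" "L \<le> N" "N - Suc t = L - 1" using Suc.prems by (auto simp: L_def)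
  have "real L * real ((L - 1) choose s) = real (L - s) * real (L choose s)"
    using binomial_absorb_comp[of L s] by (metis of_nat_mult)
  then have "real ((L - 1) choose s) = real (L - s) / real L * real (L choose s)"
    using L by (simp add: field_simps)
  also have "real (L - s) / real L \<le> real (N - s) / real N"
  proof (cases "s \<le> L")
    case True
    have "real s * L \<le> real s * N" using L by (intro mult_left_mono) auto
    then show ?thesis using L True assms by (simp add: field_simps of_nat_diff)
  qed simp
  also have "real (N - s) / real N * real (L choose s)
      \<le> real (N - s) / real N * ((real (N - s) / real N) ^ t * real (N choose s))"
    using Suc by (intro mult_left_mono) (auto simp: L_def)
  finally show ?case using L by (simp add: mult_right_mono algebra_simps)
qed simp

text \<open>A Chernoff bound for the weight missed by a uniform \<open>s\<close>-set. Membership of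
  different points is dependent, but the exponential moment expands into avoidance events with
  nonnegative coefficients, each of which is dominated by the independent case.\<close>

lemma random_set_deviation:
  fixes p :: "'a \<Rightarrow> real"
  assumes G: "finite G" "G \<noteq> {}" and s: "s \<le> card G"
    and p: "\<And>y. y \<in> G \<Longrightarrow> 0 \<le> p y" "sum p G = 1" "\<And>y. y \<in> G \<Longrightarrow> p y \<le> P"
    and P: "0 < P" and \<delta>: "0 < \<delta>" "\<delta> \<le> 1"
    and q: "q = real (card G - s) / real (card G)" "q \<le> 1 / 2"
  shows "real (card {S. S \<subseteq> G \<and> card S = s \<and> q + \<delta> \<le> sum p (G - S)})
     \<le> exp (- \<delta>\<^sup>2 / (2 * P)) * real (card G choose s)"
proof -
  \<comment> \<open>The Chernoff parameter \<open>\<delta> / P\<close> is the scale at which all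
    exponents \<open>?l * p y\<close> stay at most 1, where \<open>exp z - 1\<close> is bounded by
    \<open>z + z^2\<close>.\<close>
  let ?N = "card G" and ?l = "\<delta> / P"
  define \<S> where "\<S> = {S. S \<subseteq> G \<and> card S = s}"
  define a where "a y = exp (?l * p y) - 1" for y
  have fin: "finite \<S>" using G by (simp add: \<S>_def)
  have a0: "0 \<le> a y" if "y \<in> G" for y using p(1)[OF that] P \<delta> by (simp add: a_def)
  have q0: "0 \<le> q" by (simp add: q)
  have le: "a y \<le> ?l * p y + (?l * p y)\<^sup>2" if "y \<in> G" for y
  proof -
    have "?l * p y \<le> ?l * P" using p(3)[OF that] P \<delta> by (intro mult_left_mono) auto
    also have "\<dots> \<le> 1" using P \<delta> by simp
    finally have "?l * p y \<le> 1" .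
    then show ?thesis using exp_bound[of "?l * p y"] p(1)[OF that] P \<delta> by (simp add: a_def)
  qed
  \<comment> \<open>Multiplying out the factors \<open>1 + a y\<close> over the points missed by
    \<open>S\<close> leaves one monomial for every \<open>T\<close> that avoids
    \<open>S\<close>.\<close>
  have expand: "exp (?l * sum p (G - S)) = (\<Sum>T\<in>Pow G. prod a T * of_bool (S \<inter> T = {}))" if "S \<in> \<S>" for S
  proof -
    have "exp (?l * sum p (G - S)) = (\<Prod>y\<in>G - S. 1 + a y)"
      using G by (simp add: sum_distrib_left exp_sum a_def)
    also have "\<dots> = (\<Prod>y\<in>G. a y * of_bool (y \<notin> S) + 1)"
      using G by (intro prod.mono_neutral_cong_left) auto
    also have "\<dots> = (\<Sum>T\<in>Pow G. (\<Prod>y\<in>T. a y * of_bool (y \<notin> S)) * (\<Prod>y\<in>G - T. 1))"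
      by (rule prod_add[OF G(1)])
    also have "\<dots> = (\<Sum>T\<in>Pow G. prod a T * of_bool (S \<inter> T = {}))"
    proof (intro sum.cong refl)
      fix T assume "T \<in> Pow G"
      then have fT: "finite T" using G finite_subset by auto
      show "(\<Prod>y\<in>T. a y * of_bool (y \<notin> S)) * (\<Prod>y\<in>G - T. 1) = prod a T * of_bool (S \<inter> T = {})"
      proof (cases "S \<inter> T = {}")
        case True
        then have "(\<Prod>y\<in>T. a y * of_bool (y \<notin> S)) = prod a T" by (intro prod.cong) auto
        then show ?thesis using True by simp
      next
        case False
        then have "(\<Prod>y\<in>T. a y * of_bool (y \<notin> S)) = 0" using fT by (intro prod_zero) auto
        then show ?thesis using False by simp
      qed
    qed
    finally show ?thesis .
  qed
  have "(\<Sum>S\<in>\<S>. exp (?l * sum p (G - S))) = (\<Sum>S\<in>\<S>. \<Sum>T\<in>Pow G. prod a T * of_bool (S \<inter> T = {}))"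
    by (intro sum.cong refl expand)
  also have "\<dots> = (\<Sum>T\<in>Pow G. prod a T * (\<Sum>S\<in>\<S>. of_bool (S \<inter> T = {})))"
    by (subst sum.swap) (simp add: sum_distrib_left)
  also have "\<dots> \<le> (\<Sum>T\<in>Pow G. prod a T * (q ^ card T * real (?N choose s)))"
  proof (intro sum_mono mult_left_mono)
    fix T assume "T \<in> Pow G"
    then have T: "T \<subseteq> G" by simp
    have "(\<Sum>S\<in>\<S>. of_bool (S \<inter> T = {}) :: real) = real (card {S. S \<subseteq> G \<and> card S = s \<and> S \<inter> T = {}})"
      using fin by (simp add: sum.If_cases of_bool_def \<S>_def Int_def conj_assoc)
    also have "\<dots> \<le> q ^ card T * real (?N choose s)"
      unfolding card_subsets_avoiding[OF G(1) T] q
      using binomial_avoid_le[OF s card_mono[OF G(1) T]] .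
    finally show "(\<Sum>S\<in>\<S>. of_bool (S \<inter> T = {}) :: real) \<le> q ^ card T * real (?N choose s)" .
    show "0 \<le> prod a T" using T a0 by (intro prod_nonneg) auto
  qed
  also have "\<dots> = (\<Sum>T\<in>Pow G. (\<Prod>y\<in>T. q * a y) * (\<Prod>y\<in>G - T. 1)) * real (?N choose s)"
    by (simp add: sum_distrib_right sum_distrib_left prod.distrib mult_ac)
  also have "\<dots> = (\<Prod>y\<in>G. q * a y + 1) * real (?N choose s)"
    by (simp add: prod_add[OF G(1)])
  also have "\<dots> \<le> (\<Prod>y\<in>G. exp (q * a y)) * real (?N choose s)"
    using a0 q0 by (intro mult_right_mono prod_mono) (auto simp: add.commute)
  also have "\<dots> = exp (q * sum a G) * real (?N choose s)"
    using G by (simp add: exp_sum sum_distrib_left)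
  finally have mgf: "(\<Sum>S\<in>\<S>. exp (?l * sum p (G - S))) \<le> exp (q * sum a G) * real (?N choose s)" .
  have "sum a G \<le> (\<Sum>y\<in>G. ?l * p y + ?l\<^sup>2 * P * p y)"
  proof (rule sum_mono)
    fix y assume y: "y \<in> G"
    have "(?l * p y)\<^sup>2 = ?l\<^sup>2 * (p y * p y)" by (simp add: power2_eq_square)
    also have "\<dots> \<le> ?l\<^sup>2 * (P * p y)" using p(1,3)[OF y] by (intro mult_left_mono mult_right_mono) auto
    finally show "a y \<le> ?l * p y + ?l\<^sup>2 * P * p y" using le[OF y] by simp
  qed
  also have "\<dots> = ?l + ?l\<^sup>2 * P"
    by (simp only: sum.distrib sum_distrib_left[symmetric] p(2) mult_1_right)
  finally have "q * sum a G \<le> q * (?l + ?l\<^sup>2 * P)" using q0 by (intro mult_left_mono)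
  also have "\<dots> = ?l * q + q * (\<delta>\<^sup>2 / P)" using P by (simp add: power2_eq_square field_simps)
  \<comment> \<open>As \<open>q \<le> 1 / 2\<close>, the quadratic error consumes at most half of
    the gain \<open>\<delta>^2 / P\<close> from the deviation.\<close>
  also have "\<dots> \<le> ?l * q + 1 / 2 * (\<delta>\<^sup>2 / P)" using q P by (intro add_left_mono mult_right_mono) auto
  finally have "q * sum a G \<le> ?l * q + 1 / 2 * (\<delta>\<^sup>2 / P)" .
  moreover have "?l * (q + \<delta>) = ?l * q + \<delta>\<^sup>2 / P" by (simp add: power2_eq_square distrib_left)
  moreover have "- \<delta>\<^sup>2 / (2 * P) = - (1 / 2 * (\<delta>\<^sup>2 / P))" by simp
  ultimately have exponent: "q * sum a G - ?l * (q + \<delta>) \<le> - \<delta>\<^sup>2 / (2 * P)" by linarith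
  have "exp (?l * (q + \<delta>)) * real (card {S \<in> \<S>. q + \<delta> \<le> sum p (G - S)})
      = (\<Sum>S | S \<in> \<S> \<and> q + \<delta> \<le> sum p (G - S). exp (?l * (q + \<delta>)))" by simp
  also have "\<dots> \<le> (\<Sum>S | S \<in> \<S> \<and> q + \<delta> \<le> sum p (G - S). exp (?l * sum p (G - S)))"
    using P \<delta> by (intro sum_mono) (auto intro!: divide_right_mono mult_left_mono)
  also have "\<dots> \<le> (\<Sum>S\<in>\<S>. exp (?l * sum p (G - S)))"
    using fin by (intro sum_mono2) auto
  finally have "real (card {S \<in> \<S>. q + \<delta> \<le> sum p (G - S)})
      \<le> exp (q * sum a G) * real (?N choose s) / exp (?l * (q + \<delta>))"
    using mgf by (simp add: field_simps)
  also have "\<dots> = exp (q * sum a G - ?l * (q + \<delta>)) * real (?N choose s)" by (simp add: exp_diff)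
  also have "\<dots> \<le> exp (- \<delta>\<^sup>2 / (2 * P)) * real (?N choose s)"
    using exponent by (intro mult_right_mono) auto
  finally show ?thesis by (simp add: \<S>_def conj_assoc)
qed

subsection \<open>Majority of dependent trials\<close>

fun wins :: "('a \<Rightarrow> bool list \<Rightarrow> 'a) \<Rightarrow> ('a \<Rightarrow> bool) \<Rightarrow> nat \<Rightarrow> nat \<Rightarrow> 'a \<Rightarrow> bool list \<Rightarrow> nat" where
  "wins f g n 0 x w = 0"
| "wins f g n (Suc m) x w =
     of_bool (g (f x (take n w))) + wins f g n m (f x (take n w)) (drop n w)"

lemma wins_le: "wins f g n m x w \<le> m"
proof (induction m arbitrary: x w)
  case (Suc m)
  show ?case using Suc[of "f x (take n w)" "drop n w"] by simp
qed simp

lemma wins_Not: "wins f (\<lambda>y. \<not> g y) n m x w + wins f g n m x w = m"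
  by (induction m arbitrary: x w) auto

lemma sum_lists_append:
  fixes h :: "bool list \<Rightarrow> bool list \<Rightarrow> real"
  shows "(\<Sum>w | length w = n + l. h (take n w) (drop n w)) = (\<Sum>u | length u = n. \<Sum>v | length v = l. h u v)"
proof -
  have "(\<Sum>u | length u = n. \<Sum>v | length v = l. h u v)
      = (\<Sum>(u, v)\<in>{u. length u = n} \<times> {v. length v = l}. h u v)"
    by (simp add: sum.cartesian_product)
  also have "\<dots> = (\<Sum>w | length w = n + l. h (take n w) (drop n w))"
    by (rule sum.reindex_bij_witness[of _ "\<lambda>w. (take n w, drop n w)" "\<lambda>(u, v). u @ v"]) auto
  finally show ?thesis ..
qed

lemma finite_bool_lists: "finite {w :: bool list. length w = n}"
  using finite_lists_length_eq[of "UNIV :: bool set" n] by simp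

lemma card_bool_lists: "card {w :: bool list. length w = n} = 2 ^ n"
  using card_lists_length_eq[of "UNIV :: bool set" n] by simp

text \<open>A weight that falls with each success and rises with each failure. It is at least 1
  unless successes are in the majority, so its average bounds the failure probability.\<close>

fun potential :: "real \<Rightarrow> ('a \<Rightarrow> bool list \<Rightarrow> 'a) \<Rightarrow> ('a \<Rightarrow> bool) \<Rightarrow> nat \<Rightarrow> nat \<Rightarrow> 'a \<Rightarrow> bool list \<Rightarrow> real" where
  "potential \<beta> f g n 0 x w = 1"
| "potential \<beta> f g n (Suc m) x w =
     (if g (f x (take n w)) then \<beta> else 1 / \<beta>) * potential \<beta> f g n m (f x (take n w)) (drop n w)"

lemma potential_nonneg: "0 < \<beta> \<Longrightarrow> 0 \<le> potential \<beta> f g n m x w"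
  by (induction m arbitrary: x w) auto

lemma potential_eq: "0 < \<beta> \<Longrightarrow> potential \<beta> f g n m x w = \<beta> ^ wins f g n m x w * (1 / \<beta>) ^ (m - wins f g n m x w)"
proof (induction m arbitrary: x w)
  case (Suc m)
  then show ?case using wins_le[of f g n m "f x (take n w)" "drop n w"] by (simp add: Suc_diff_le)
qed simp

lemma potential_ge_1:
  assumes "0 < \<beta>" "\<beta> \<le> 1" "2 * wins f g n m x w \<le> m"
  shows "1 \<le> potential \<beta> f g n m x w"
proof -
  let ?k = "wins f g n m x w"
  have "1 = \<beta> ^ ?k * (1 / \<beta>) ^ ?k" using assms by (simp add: power_divide)
  also have "\<dots> \<le> \<beta> ^ ?k * (1 / \<beta>) ^ (m - ?k)"
    using assms by (intro mult_left_mono power_increasing) auto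
  finally show ?thesis using assms by (simp add: potential_eq)
qed

text \<open>The first \<open>n\<close> coins are averaged out. Wherever they lead, the next state is
  in \<open>I\<close> and the same bound applies, so independence of the trials is replaced by a
  uniform conditional bound. The last \<open>r\<close> coins stay unread.\<close>

lemma sum_potential_le:
  assumes \<delta>: "0 < \<delta>" "\<delta> < 1 / 2"
    and closed: "\<And>x u. x \<in> I \<Longrightarrow> length u = n \<Longrightarrow> f x u \<in> I"
    and good: "\<And>x. x \<in> I \<Longrightarrow> real (card {u. length u = n \<and> \<not> g (f x u)}) \<le> (1 / 2 - \<delta>) * 2 ^ n"
  shows "x \<in> I \<Longrightarrow> (\<Sum>w | length w = m * n + r. potential (1 - 2 * \<delta>) f g n m x w)
     \<le> (1 - 2 * \<delta>\<^sup>2) ^ m * 2 ^ (m * n + r)"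
proof (induction m arbitrary: x)
  case 0
  then show ?case by (simp add: card_bool_lists)
next
  case (Suc m)
  let ?\<beta> = "1 - 2 * \<delta>" and ?\<rho> = "1 - 2 * \<delta>\<^sup>2" and ?l = "m * n + r"
  let ?wt = "\<lambda>u. if g (f x u) then ?\<beta> else 1 / ?\<beta>"
  have \<beta>: "0 < ?\<beta>" "?\<beta> \<le> 1" using \<delta> by auto
  have \<rho>0: "0 \<le> ?\<rho>" using \<delta> power_mono[of \<delta> "1/2" 2] by (simp add: power2_eq_square)
  define bad where "bad = real (card {u. length u = n \<and> \<not> g (f x u)})"
  have "(\<Sum>u | length u = n. ?wt u) = (\<Sum>u | length u = n. ?\<beta> + (1 / ?\<beta> - ?\<beta>) * of_bool (\<not> g (f x u)))"
    by (intro sum.cong) auto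
  also have "\<dots> = 2 ^ n * ?\<beta> + (1 / ?\<beta> - ?\<beta>) * (\<Sum>u | length u = n. of_bool (\<not> g (f x u)))"
    by (simp add: sum.distrib card_bool_lists sum_distrib_left)
  also have "(\<Sum>u | length u = n. of_bool (\<not> g (f x u)) :: real) = bad"
    using finite_bool_lists[of n] by (simp add: sum.If_cases of_bool_def Int_def bad_def)
  also have "2 ^ n * ?\<beta> + (1 / ?\<beta> - ?\<beta>) * bad \<le> 2 ^ n * ?\<beta> + (1 / ?\<beta> - ?\<beta>) * ((1 / 2 - \<delta>) * 2 ^ n)"
  proof (intro add_left_mono mult_left_mono)
    have "1 \<le> 1 / ?\<beta>" using \<beta> by simp
    then show "0 \<le> 1 / ?\<beta> - ?\<beta>" using \<beta> by linarith
    show "bad \<le> (1 / 2 - \<delta>) * 2 ^ n" using good[OF Suc.prems] by (simp add: bad_def)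
  qed
  also have "\<dots> = ?\<rho> * 2 ^ n"
  proof -
    \<comment> \<open>The base \<open>1 - 2 * \<delta>\<close> is chosen so that failures contribute
      exactly 1/2 at the extremal failure rate; successes add
      \<open>(1 - 4 * \<delta>^2) / 2\<close>.\<close>
    have half: "1 / ?\<beta> * (1 / 2 - \<delta>) = 1 / 2" using \<beta> by (simp add: field_simps)
    have "?\<beta> + (1 / ?\<beta> - ?\<beta>) * (1 / 2 - \<delta>) = ?\<beta> + (1 / 2 - ?\<beta> * (1 / 2 - \<delta>))"
      by (simp only: left_diff_distrib half)
    also have "\<dots> = ?\<rho>" by (simp add: algebra_simps power2_eq_square)
    finally have "?\<beta> + (1 / ?\<beta> - ?\<beta>) * (1 / 2 - \<delta>) = ?\<rho>" .
    moreover have "2 ^ n * b + (c - b) * (h * 2 ^ n) = (b + (c - b) * h) * 2 ^ n" for b c h :: real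
      by (simp add: algebra_simps)
    ultimately show ?thesis by metis
  qed
  finally have wt: "(\<Sum>u | length u = n. ?wt u) \<le> ?\<rho> * 2 ^ n" .
  have "(\<Sum>w | length w = Suc m * n + r. potential ?\<beta> f g n (Suc m) x w)
      = (\<Sum>u | length u = n. \<Sum>v | length v = ?l. ?wt u * potential ?\<beta> f g n m (f x u) v)"
    using sum_lists_append[of "\<lambda>u v. ?wt u * potential ?\<beta> f g n m (f x u) v" n ?l]
    by (simp add: add.assoc)
  also have "\<dots> = (\<Sum>u | length u = n. ?wt u * (\<Sum>v | length v = ?l. potential ?\<beta> f g n m (f x u) v))"
    by (simp add: sum_distrib_left)
  also have "\<dots> \<le> (\<Sum>u | length u = n. ?wt u * (?\<rho> ^ m * 2 ^ ?l))"
    using Suc \<beta> closed by (intro sum_mono mult_left_mono) auto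
  also have "\<dots> = (\<Sum>u | length u = n. ?wt u) * (?\<rho> ^ m * 2 ^ ?l)"
    by (simp add: sum_distrib_right)
  also have "\<dots> \<le> (?\<rho> * 2 ^ n) * (?\<rho> ^ m * 2 ^ ?l)"
    using wt \<rho>0 by (intro mult_right_mono) auto
  also have "\<dots> = ?\<rho> ^ Suc m * 2 ^ (Suc m * n + r)" by (simp add: power_add)
  finally show ?case .
qed

text \<open>Markov's inequality for the potential; a tie counts as failure.\<close>

lemma card_minority_wins_le:
  assumes \<delta>: "0 < \<delta>" "\<delta> < 1 / 2"
    and closed: "\<And>x u. x \<in> I \<Longrightarrow> length u = n \<Longrightarrow> f x u \<in> I"
    and good: "\<And>x. x \<in> I \<Longrightarrow> real (card {u. length u = n \<and> \<not> g (f x u)}) \<le> (1 / 2 - \<delta>) * 2 ^ n"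
    and x: "x \<in> I"
  shows "real (card {w. length w = m * n + r \<and> 2 * wins f g n m x w \<le> m}) \<le> (1 - 2 * \<delta>\<^sup>2) ^ m * 2 ^ (m * n + r)"
proof -
  let ?A = "{w. length w = m * n + r \<and> 2 * wins f g n m x w \<le> m}"
  have "real (card ?A) \<le> (\<Sum>w\<in>?A. potential (1 - 2 * \<delta>) f g n m x w)"
    using sum_mono[of ?A "\<lambda>_. 1" "potential (1 - 2 * \<delta>) f g n m x"]
      potential_ge_1[of "1 - 2 * \<delta>" f g n m x] \<delta> by simp
  also have "\<dots> \<le> (\<Sum>w | length w = m * n + r. potential (1 - 2 * \<delta>) f g n m x w)"
    using \<delta> finite_bool_lists by (intro sum_mono2) (auto intro!: potential_nonneg)
  also have "\<dots> \<le> (1 - 2 * \<delta>\<^sup>2) ^ m * 2 ^ (m * n + r)"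
    by (rule sum_potential_le[OF assms])
  finally show ?thesis .
qed

subsection \<open>The program\<close>

text \<open>Truncated subtraction makes \<open>M\<close> and \<open>m\<close> the maximum and the minimum of \<open>a\<close> and \<open>b\<close>.\<close>

definition edge_expr :: "expr \<Rightarrow> expr \<Rightarrow> expr" where
  "edge_expr a b =
     (let M = Plus a (Minus b a); m = Minus a (Minus a b)
      in Plus (Div (Times M (Minus M (Const 1))) (Const 2)) m)"

definition pair_index :: "nat \<Rightarrow> nat \<Rightarrow> nat" where
  "pair_index p q = edge_index (min p q) (max p q)"

abbreviation (input) "rN \<equiv> 0 :: nat"
abbreviation (input) "rV \<equiv> 2 :: nat"
abbreviation (input) "rW \<equiv> 3 :: nat"
abbreviation (input) "rSel \<equiv> 4 :: nat"
abbreviation (input) "rRun \<equiv> 5 :: nat"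
abbreviation (input) "rEnd \<equiv> 6 :: nat"
abbreviation (input) "rTwin \<equiv> 7 :: nat"
abbreviation (input) "rCoin \<equiv> 8 :: nat"
abbreviation (input) "rTmp \<equiv> 9 :: nat"
abbreviation (input) "rAns \<equiv> 10 :: nat"
abbreviation (input) "rCnt \<equiv> 11 :: nat"

text \<open>The cells from address \<open>n * n\<close> onwards lie beyond the edge vector; cell \<open>n * n + v\<close> flags the
  pair \<open>v, v + 1\<close> as selected.\<close>

definition flag_expr :: expr where
  "flag_expr = Plus (Times (Reg rN) (Reg rN)) (Reg rV)"

text \<open>Nonzero iff \<open>w\<close> is neither \<open>v\<close> nor \<open>v + 1\<close>.\<close>

definition outside_expr :: expr where
  "outside_expr = Plus (Minus (Reg rV) (Reg rW)) (Minus (Reg rW) (Plus (Reg rV) (Const 1)))"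

definition VW_expr :: expr where "VW_expr = edge_expr (Reg rV) (Reg rW)"

definition V'W_expr :: expr where "V'W_expr = edge_expr (Plus (Reg rV) (Const 1)) (Reg rW)"

definition incr :: "nat \<Rightarrow> com" where
  "incr r = Assign r (Plus (Reg r) (Const 1))"

definition twins_com :: com where
  "twins_com =
     While (Minus (Reg rN) (Reg rW))
       (Seq (IfElse outside_expr
               (IfElse (Plus (Minus (Load VW_expr) (Load V'W_expr)) (Minus (Load V'W_expr) (Load VW_expr)))
                  (Assign rTwin (Const 0)) Skip)
               Skip)
            (incr rW))"

text \<open>For \<open>K \<ge> 2\<close> the truncated difference of \<open>rRun\<close> and
  \<open>K - 2\<close> is nonzero exactly when the run has length at least
  \<open>K - 1\<close>.\<close>

definition scan_body :: "nat \<Rightarrow> com" where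
  "scan_body K =
     Seq (Assign rTwin (Const 1))
    (Seq (Assign rW (Const 0))
    (Seq twins_com
    (Seq (IfElse (Reg rTwin)
            (Seq (incr rRun) (Assign rSel (Const 0)))
            (Seq (Assign rRun (Const 0)) (Assign rSel (Minus (Const 1) (Reg rSel)))))
    (Seq (Store flag_expr (Reg rSel))
    (Seq (IfElse (Minus (Reg rRun) (Const (K - 2)))
            (Assign rEnd (Plus (Reg rV) (Const 2))) Skip)
         (incr rV))))))"

text \<open>The loop stops at \<open>v = n - 1\<close>. The last store clears the flag of the
  nonexistent pair \<open>n - 1, n\<close>, so that shaking may consult a flag at every
  vertex.\<close>

definition scan_com :: "nat \<Rightarrow> com" where
  "scan_com K =
     Seq (Assign rV (Const 0))
    (Seq (Assign rSel (Const 0))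
    (Seq (Assign rRun (Const 0))
    (Seq (Assign rEnd (Const 0))
    (Seq (While (Minus (Minus (Reg rN) (Reg rV)) (Const 1)) (scan_body K))
         (Store flag_expr (Const 0))))))"

text \<open>The two truncated differences of the guard detect a vertex before and after the block,
  respectively.\<close>

definition toggle_com :: "nat \<Rightarrow> com" where
  "toggle_com K =
     IfElse (Plus (Minus (Minus (Reg rEnd) (Const K)) (Reg rV))
                  (Minus (Plus (Reg rV) (Const 1)) (Reg rEnd)))
       (Seq (Assign rW (Minus (Reg rEnd) (Const K)))
            (While (Minus (Reg rEnd) (Reg rW))
               (Seq (Store (edge_expr (Reg rW) (Reg rV))
                       (Minus (Const 1) (Load (edge_expr (Reg rW) (Reg rV)))))
                    (incr rW))))
       Skip"

definition swap_com :: com where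
  "swap_com =
     Seq (Assign rW (Const 0))
         (While (Minus (Reg rN) (Reg rW))
            (Seq (IfElse outside_expr
                    (Seq (Assign rTmp (Load VW_expr))
                    (Seq (Store VW_expr (Load V'W_expr))
                         (Store V'W_expr (Reg rTmp))))
                    Skip)
                 (incr rW)))"

definition shake_com :: "nat \<Rightarrow> com" where
  "shake_com K =
     Seq (Assign rV (Const 0))
         (While (Minus (Reg rN) (Reg rV))
            (Seq (Coin rCoin)
            (Seq (IfElse (Reg rCoin)
                    (IfElse (Reg rEnd) (toggle_com K) (IfElse (Load flag_expr) swap_com Skip))
                    Skip)
                 (incr rV))))"

definition trial_com :: "nat \<Rightarrow> com" where
  "trial_com K =
     Seq (scan_com K)
    (Seq (shake_com K)
    (Seq (Query rAns (Const 0))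
         (Assign rCnt (Plus (Reg rCnt) (Reg rAns)))))"

text \<open>The trials are unrolled because \<open>m\<close> is a constant: a loop around them would
  raise the syntactic time degree to 3.\<close>

fun trials_com :: "nat \<Rightarrow> nat \<Rightarrow> com" where
  "trials_com K 0 = Skip"
| "trials_com K (Suc m) = Seq (trial_com K) (trials_com K m)"

definition reduction_com :: "nat \<Rightarrow> nat \<Rightarrow> com" where
  "reduction_com K m =
     Seq (trials_com K m)
         (IfElse (Minus (Times (Const 2) (Reg rCnt)) (Const m))
            (Assign rN (Const 1)) (Assign rN (Const 0)))"

lemma time_degree_reduction_com: "time_degree (reduction_com K m) \<le> 2"
proof -
  have "time_degree (trial_com K) \<le> 2"
    by (simp add: trial_com_def scan_com_def scan_body_def twins_com_def shake_com_def toggle_com_def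
        swap_com_def incr_def)
  then have "time_degree (trials_com K m) \<le> 2" by (induction m) auto
  then show ?thesis by (simp add: reduction_com_def)
qed

subsection \<open>Correctness of the program\<close>

lemma pair_index_less: "p < n \<Longrightarrow> q < n \<Longrightarrow> p \<noteq> q \<Longrightarrow> pair_index p q < n * n"
proof -
  assume "p < n" "q < n" "p \<noteq> q"
  then have "pair_index p q < n choose 2"
    unfolding pair_index_def by (intro edge_index_less) auto
  also have "\<dots> \<le> n * (n - 1)" by (simp add: choose_two)
  also have "\<dots> \<le> n * n" by simp
  finally show ?thesis .
qed

lemma eval_edge_expr: "eval R M (edge_expr a b) = pair_index (eval R M a) (eval R M b)"
proof -
  have "p + (q - p) = max p q" "p - (p - q) = min p q" for p q :: nat by auto
  then show ?thesis
    by (simp add: edge_expr_def Let_def pair_index_def edge_index_def choose_two)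
qed

definition holds_graph :: "nat \<Rightarrow> mem \<Rightarrow> graph \<Rightarrow> bool" where
  "holds_graph n M x \<longleftrightarrow> x \<in> graphs n \<and>
     (\<forall>i j. i < j \<longrightarrow> j < n \<longrightarrow> M (edge_index i j) = of_bool ({i, j} \<in> x))"

lemma holds_graphD:
  assumes "holds_graph n M x" "p < n" "q < n" "p \<noteq> q"
  shows "M (pair_index p q) = of_bool ({p, q} \<in> x)"
proof (cases "p < q")
  case True
  then show ?thesis using assms by (simp add: holds_graph_def pair_index_def)
next
  case False
  then have "q < p" using assms by simp
  then show ?thesis using assms by (simp add: holds_graph_def pair_index_def insert_commute[of p q])
qed

lemma holds_graph_set_edge:
  assumes "holds_graph n M x" "p < n" "q < n" "p \<noteq> q"
  shows "holds_graph n (M(pair_index p q := of_bool b)) (set_edge x p q b)"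
  unfolding holds_graph_def
proof (intro conjI allI impI)
  show "set_edge x p q b \<in> graphs n"
    using assms by (auto simp: holds_graph_def intro: set_edge_graphs)
  fix i j assume ij: "i < j" "j < n"
  have M: "M (edge_index i j) = of_bool ({i, j} \<in> x)" using assms(1) ij by (simp add: holds_graph_def)
  have iff: "edge_index i j = pair_index p q \<longleftrightarrow> {i, j} = {p, q}"
  proof
    assume "edge_index i j = pair_index p q"
    then have "i = min p q \<and> j = max p q"
      unfolding pair_index_def using ij assms(4) by (intro edge_index_inj) auto
    then show "{i, j} = {p, q}" by (auto simp: min_def max_def)
  next
    assume "{i, j} = {p, q}"
    then have "i = min p q \<and> j = max p q" using ij by (auto simp: doubleton_eq_iff)
    then show "edge_index i j = pair_index p q" by (simp add: pair_index_def)
  qed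
  show "(M(pair_index p q := of_bool b)) (edge_index i j) = of_bool ({i, j} \<in> set_edge x p q b)"
    using M iff by (simp add: set_edge_iff)
qed

lemma holds_graph_flag:
  assumes "holds_graph n M x" "n * n \<le> a"
  shows "holds_graph n (M(a := v)) x"
  unfolding holds_graph_def
proof (intro conjI allI impI)
  show "x \<in> graphs n" using assms by (simp add: holds_graph_def)
  fix i j assume ij: "i < j" "j < n"
  then have "pair_index i j < n * n" by (intro pair_index_less) auto
  then have "edge_index i j \<noteq> a" using ij assms(2) by (simp add: pair_index_def)
  then show "(M(a := v)) (edge_index i j) = of_bool ({i, j} \<in> x)"
    using assms(1) ij by (simp add: holds_graph_def)
qed

lemma graph_at_holds_graph: "holds_graph n M x \<Longrightarrow> graph_at n 0 M = x"
proof -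
  assume h: "holds_graph n M x"
  show ?thesis
  proof (rule graphs_eqI[of _ n])
    show "graph_at n 0 M \<in> graphs n" by (force simp: graph_at_def graphs_def)
    show "x \<in> graphs n" using h by (simp add: holds_graph_def)
    have *: "{i, j} \<in> graph_at n 0 M \<longleftrightarrow> {i, j} \<in> x" if "i < j" "j < n" for i j
    proof -
      have "{i, j} \<in> graph_at n 0 M \<longleftrightarrow> M (edge_index i j) \<noteq> 0"
        using that by (auto simp: graph_at_def doubleton_eq_iff)
      then show ?thesis using h that by (simp add: holds_graph_def)
    qed
    fix i j assume "i < n" "j < n" "i \<noteq> j"
    then show "{i, j} \<in> graph_at n 0 M \<longleftrightarrow> {i, j} \<in> x"
      using *[of i j] *[of j i] by (cases "i < j") (simp_all add: insert_commute[of j i])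
  qed
qed

lemma holds_graph_init_mem:
  assumes "x \<in> graphs n"
  shows "holds_graph n (init_mem n x) x"
  unfolding holds_graph_def
proof (intro conjI allI impI assms)
  fix i j assume "i < j" "j < n"
  then show "init_mem n x (edge_index i j) = of_bool ({i, j} \<in> x)"
    by (auto simp: init_mem_def dest: edge_index_inj)
qed

context
  fixes n :: nat and Orc :: "graph \<Rightarrow> bool"
  assumes n2: "2 \<le> n"
begin

private lemmas wp_rules = wp_Seq[OF n2] wp_Assign[OF n2] wp_Store[OF n2] wp_Skip[OF n2]

private lemma wp_incr:
  "R r + 1 \<le> n \<Longrightarrow> Q (R(r := R r + 1)) M w \<Longrightarrow> wp n Orc (incr r) Q R M w"
  unfolding incr_def by (intro wp_rules) simp_all

private lemma wp_twins_com:
  assumes "R rN = n" "Suc (R rV) < n" "R rW = 0" "R rTwin = 1" "holds_graph n M x"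
    and Q: "Q (R(rW := n, rTwin := of_bool (twins n x (R rV)))) M w"
  shows "wp n Orc twins_com Q R M w"
proof -
  let ?v = "R rV"
  define agree where "agree i \<longleftrightarrow> (\<forall>u<i. u \<noteq> ?v \<longrightarrow> u \<noteq> Suc ?v \<longrightarrow> ({?v, u} \<in> x \<longleftrightarrow> {Suc ?v, u} \<in> x))" for i
  define I where "I i R' M' w' \<longleftrightarrow> R' = R(rW := i, rTwin := of_bool (agree i)) \<and> M' = M \<and> w' = w" for i R' M' w'
  show ?thesis
    unfolding twins_com_def
  proof (rule wp_While[OF n2, where N = n and I = I])
    show "I 0 R M w" using assms by (auto simp: I_def agree_def)
    show "Q R' M' w'" if "I n R' M' w'" for R' M' w'
      using that Q by (simp add: I_def agree_def twins_def)
    fix i R' M' w' assume i: "i < n" and I: "I i R' M' w'"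
    then have R': "R' = R(rW := i, rTwin := of_bool (agree i))" "M' = M" "w' = w" by (auto simp: I_def)
    have out: "eval R' M' outside_expr \<noteq> 0 \<longleftrightarrow> i \<noteq> ?v \<and> i \<noteq> Suc ?v"
      by (auto simp: outside_expr_def R')
    have ld: "eval R' M' (Load VW_expr) = of_bool ({?v, i} \<in> x)"
      "eval R' M' (Load V'W_expr) = of_bool ({Suc ?v, i} \<in> x)" if "i \<noteq> ?v" "i \<noteq> Suc ?v"
      using holds_graphD[OF assms(5), of ?v i] holds_graphD[OF assms(5), of "Suc ?v" i] that i assms(2)
      by (auto simp: VW_expr_def V'W_expr_def eval_edge_expr R')
    have ag: "agree (Suc i) \<longleftrightarrow> agree i \<and> (i \<noteq> ?v \<longrightarrow> i \<noteq> Suc ?v \<longrightarrow> ({?v, i} \<in> x \<longleftrightarrow> {Suc ?v, i} \<in> x))"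
      by (auto simp: agree_def less_Suc_eq)
    show "wp n Orc (Seq (IfElse outside_expr
               (IfElse (Plus (Minus (Load VW_expr) (Load V'W_expr)) (Minus (Load V'W_expr) (Load VW_expr)))
                  (Assign rTwin (Const 0)) Skip) Skip) (incr rW)) (I (Suc i)) R' M' w'"
    proof (intro wp_rules(1) wp_If[OF n2])
      assume "eval R' M' outside_expr \<noteq> 0"
      then have o: "i \<noteq> ?v" "i \<noteq> Suc ?v" using out by auto
      {
        assume "eval R' M' (Plus (Minus (Load VW_expr) (Load V'W_expr)) (Minus (Load V'W_expr) (Load VW_expr))) \<noteq> 0"
        then have "{?v, i} \<in> x \<longleftrightarrow> {Suc ?v, i} \<notin> x"
          unfolding eval.simps(4,5) ld[OF o] by (auto split: if_splits)
        then have "\<not> agree (Suc i)" using ag o by blast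
        then show "wp n Orc (Assign rTwin (Const 0)) (wp n Orc (incr rW) (I (Suc i))) R' M' w'"
          using i by (intro wp_rules wp_incr) (auto simp: R' I_def)
      next
        assume "eval R' M' (Plus (Minus (Load VW_expr) (Load V'W_expr)) (Minus (Load V'W_expr) (Load VW_expr))) = 0"
        then have "{?v, i} \<in> x \<longleftrightarrow> {Suc ?v, i} \<in> x"
          unfolding eval.simps(4,5) ld[OF o] by (auto split: if_splits)
        then have "agree (Suc i) = agree i" using ag by blast
        then show "wp n Orc Skip (wp n Orc (incr rW) (I (Suc i))) R' M' w'"
          using i by (intro wp_rules wp_incr) (auto simp: R' I_def)
      }
    next
      assume "eval R' M' outside_expr = 0"
      then have "agree (Suc i) = agree i" using ag out by blast
      then show "wp n Orc Skip (wp n Orc (incr rW) (I (Suc i))) R' M' w'"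
        using i by (intro wp_rules wp_incr) (auto simp: R' I_def)
    qed
  qed (auto simp: I_def assms(1))
qed

private definition scanned :: "nat \<Rightarrow> graph \<Rightarrow> nat \<Rightarrow> nat \<Rightarrow> regs \<Rightarrow> mem \<Rightarrow> bool" where
  "scanned K x c v R M \<longleftrightarrow> R rN = n \<and> R rV = v \<and> R rCnt = c \<and> R rSel = of_bool (sel n x v) \<and>
     R rRun = run_len n x v \<and> R rEnd = block_end n K x v \<and> holds_graph n M x \<and>
     (\<forall>u<v. M (n * n + u) = of_bool (sel n x (Suc u)))"

private lemma wp_scan_body:
  assumes K: "2 \<le> K" and v: "Suc v < n" and s: "scanned K x c v R M"
  shows "wp n Orc (scan_body K) (\<lambda>R' M' w'. scanned K x c (Suc v) R' M' \<and> w' = w) R M w"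
proof -
  have s': "R rN = n" "R rV = v" "R rCnt = c" "R rSel = of_bool (sel n x v)"
     "R rRun = run_len n x v" "R rEnd = block_end n K x v" "holds_graph n M x"
     "\<And>u. u < v \<Longrightarrow> M (n * n + u) = of_bool (sel n x (Suc u))"
    using s by (auto simp: scanned_def)
  have M': "holds_graph n (M(n * n + v := b)) x" for b by (rule holds_graph_flag[OF s'(7)]) simp
  have rl: "run_len n x v < n" using run_len_le[of n x v] v by simp
  show ?thesis
    unfolding scan_body_def
    apply (intro wp_rules wp_twins_com[where x = x] wp_If[OF n2] wp_incr)
    using s' v rl K M' by (auto simp: flag_expr_def scanned_def less_Suc_eq of_bool_def split: if_splits)
qed

private lemma wp_scan_com:
  assumes K: "2 \<le> K" and R: "R rN = n" "R rCnt = c" and M: "holds_graph n M x"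
    and Q: "\<And>R' M'. R' rN = n \<Longrightarrow> R' rCnt = c \<Longrightarrow> R' rEnd = block_end n K x (n - 1) \<Longrightarrow>
      holds_graph n M' x \<Longrightarrow> (\<forall>v<n. M' (n * n + v) = of_bool (picked n x v)) \<Longrightarrow> Q R' M' w"
  shows "wp n Orc (scan_com K) Q R M w"
  unfolding scan_com_def
proof (intro wp_rules)
  let ?Q = "wp n Orc (Store flag_expr (Const 0)) Q"
  show "wp n Orc (While (Minus (Minus (Reg rN) (Reg rV)) (Const 1)) (scan_body K)) ?Q 
     (R(rV := eval R M (Const 0),
         rSel := eval (R(rV := eval R M (Const 0))) M (Const 0),
         rRun := eval (R(rV := eval R M (Const 0), rSel := eval (R(rV := eval R M (Const 0))) M (Const 0))) M (Const 0),
         rEnd := eval (R(rV := eval R M (Const 0), rSel := eval (R(rV := eval R M (Const 0))) M (Const 0),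
           rRun := eval (R(rV := eval R M (Const 0), rSel := eval (R(rV := eval R M (Const 0))) M (Const 0))) M (Const 0))) M (Const 0))) M w"
  proof (rule wp_While[OF n2, where N = "n - 1" and I = "\<lambda>v R' M' w'. scanned K x c v R' M' \<and> w' = w"])
    fix v R' M' w' assume "v < n - 1" "scanned K x c v R' M' \<and> w' = w"
    then show "wp n Orc (scan_body K) (\<lambda>R' M' w'. scanned K x c (Suc v) R' M' \<and> w' = w) R' M' w'"
      using wp_scan_body[OF K, of v x c R' M' w'] by simp
  next
    fix R' M' w' assume "scanned K x c (n - 1) R' M' \<and> w' = w"
    then have s: "R' rN = n" "R' rV = n - 1" "R' rCnt = c" "R' rEnd = block_end n K x (n - 1)"
      "holds_graph n M' x" "\<And>u. u < n - 1 \<Longrightarrow> M' (n * n + u) = of_bool (sel n x (Suc u))" "w' = w"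
      by (auto simp: scanned_def)
    show "?Q R' M' w'"
    proof (intro wp_rules)
      let ?M = "M'(n * n + (n - 1) := 0)"
      have "\<forall>v<n. ?M (n * n + v) = of_bool (picked n x v)"
      proof (intro allI impI)
        fix v assume "v < n"
        then show "?M (n * n + v) = of_bool (picked n x v)"
          using s(6)[of v] by (cases "v = n - 1") (auto simp: picked_def simp del: sel.simps)
      qed
      then have "Q R' ?M w" using s holds_graph_flag[OF s(5)] by (intro Q) auto
      then show "Q R' (M'(eval R' M' flag_expr := eval R' M' (Const 0))) w'"
        using s by (simp add: flag_expr_def)
    qed simp
  qed (use R M in \<open>auto simp: scanned_def\<close>)
qed simp_all

text \<open>The frame condition beyond \<open>n * n\<close> protects the selection flags, which are
  still being read while the edge cells change.\<close>

private lemma wp_toggle_com: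
  assumes K: "2 \<le> K" and R: "R rN = n" "R rV = v" "R rCnt = c" "R rEnd = b" and b: "K \<le> b" "b \<le> n" and v: "v < n"
    and M: "holds_graph n M y"
    and Q: "\<And>R' M'. R' rN = n \<Longrightarrow> R' rV = v \<Longrightarrow> R' rCnt = c \<Longrightarrow> R' rEnd = b \<Longrightarrow>
      holds_graph n M' (if v \<in> {b - K..<b} then y else toggle_upto y (b - K) v K) \<Longrightarrow>
      (\<forall>a\<ge>n * n. M' a = M a) \<Longrightarrow> Q R' M' w"
  shows "wp n Orc (toggle_com K) Q R M w"
proof -
  let ?e = "Plus (Minus (Minus (Reg rEnd) (Const K)) (Reg rV)) (Minus (Plus (Reg rV) (Const 1)) (Reg rEnd))"
  have e: "eval R M ?e = 0 \<longleftrightarrow> v \<in> {b - K..<b}" using R v b K by auto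
  define I where "I i R' M' w' \<longleftrightarrow> R' rN = n \<and> R' rV = v \<and> R' rCnt = c \<and> R' rEnd = b \<and> R' rW = b - K + i \<and>
      holds_graph n M' (toggle_upto y (b - K) v i) \<and> (\<forall>a\<ge>n * n. M' a = M a) \<and> w' = w" for i R' M' w'
  show ?thesis
    unfolding toggle_com_def
  proof (intro wp_If[OF n2] wp_rules)
    assume "eval R M ?e = 0"
    then show "Q R M w" using R M e by (intro Q) auto
  next
    assume "eval R M ?e \<noteq> 0"
    then have out: "v \<notin> {b - K..<b}" by (simp only: e not_False_eq_True simp_thms)
    show "eval R M (Minus (Reg rEnd) (Const K)) \<le> n" using R b by simp
    show "wp n Orc (While (Minus (Reg rEnd) (Reg rW))
               (Seq (Store (edge_expr (Reg rW) (Reg rV)) (Minus (Const 1) (Load (edge_expr (Reg rW) (Reg rV)))))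
                    (incr rW))) Q (R(rW := eval R M (Minus (Reg rEnd) (Const K)))) M w"
    proof (rule wp_While[OF n2, where N = K and I = I])
      show "I 0 (R(rW := eval R M (Minus (Reg rEnd) (Const K)))) M w" using R M by (simp add: I_def)
      show "K \<le> n" using b by simp
      show "Q R' M' w'" if "I K R' M' w'" for R' M' w'
        using that out Q[of R' M'] by (auto simp: I_def)
      fix i R' M' w' assume i: "i < K" and "I i R' M' w'"
      then have I: "R' rN = n" "R' rV = v" "R' rCnt = c" "R' rEnd = b" "R' rW = b - K + i"
        "holds_graph n M' (toggle_upto y (b - K) v i)" "\<And>a. n * n \<le> a \<Longrightarrow> M' a = M a" "w' = w"
        by (auto simp: I_def)
      have p: "b - K + i < n" "b - K + i \<noteq> v" "b - K + i < b" using i b out by auto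
      have ld: "M' (pair_index (b - K + i) v) = of_bool ({b - K + i, v} \<in> toggle_upto y (b - K) v i)"
        by (rule holds_graphD[OF I(6) p(1) v p(2)])
      let ?M = "M'(pair_index (b - K + i) v := of_bool ({b - K + i, v} \<notin> toggle_upto y (b - K) v i))"
      have h: "holds_graph n ?M (toggle_upto y (b - K) v (Suc i))"
        using holds_graph_set_edge[OF I(6) p(1) v p(2)] by (simp add: Let_def)
      have f: "\<forall>a\<ge>n * n. ?M a = M a" using pair_index_less[OF p(1) v p(2)] I(7) by auto
      show "wp n Orc (Seq (Store (edge_expr (Reg rW) (Reg rV)) (Minus (Const 1) (Load (edge_expr (Reg rW) (Reg rV)))))
                    (incr rW)) (I (Suc i)) R' M' w'"
      proof (intro wp_rules wp_incr)
        have ev: "eval R' M' (Minus (Const 1) (Load (edge_expr (Reg rW) (Reg rV))))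
            = of_bool ({b - K + i, v} \<notin> toggle_upto y (b - K) v i)"
          by (simp add: eval_edge_expr I ld)
        show "eval R' M' (Minus (Const 1) (Load (edge_expr (Reg rW) (Reg rV)))) \<le> n"
          unfolding ev using n2 by simp
        show "R' rW + 1 \<le> n" using I p by simp
        show "I (Suc i) (R'(rW := R' rW + 1)) (M'(eval R' M' (edge_expr (Reg rW) (Reg rV)) :=
            eval R' M' (Minus (Const 1) (Load (edge_expr (Reg rW) (Reg rV)))))) w'"
          unfolding ev eval_edge_expr using I h f unfolding I_def by simp
      qed
      show "eval R' M' (Minus (Reg rEnd) (Reg rW)) \<noteq> 0" using I p by simp
    next
      show "eval R' M' (Minus (Reg rEnd) (Reg rW)) = 0" if "I K R' M' w'" for R' M' w'
        using that b by (simp add: I_def)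
    qed
  qed
qed

private lemma wp_swap_com:
  assumes R: "R rN = n" "R rV = v" "R rCnt = c" "R rEnd = b" and v: "Suc v < n"
    and M: "holds_graph n M y"
    and Q: "\<And>R' M'. R' rN = n \<Longrightarrow> R' rV = v \<Longrightarrow> R' rCnt = c \<Longrightarrow> R' rEnd = b \<Longrightarrow>
      holds_graph n M' (swap_upto y v n) \<Longrightarrow> (\<forall>a\<ge>n * n. M' a = M a) \<Longrightarrow> Q R' M' w"
  shows "wp n Orc swap_com Q R M w"
proof -
  define I where "I i R' M' w' \<longleftrightarrow> R' rN = n \<and> R' rV = v \<and> R' rCnt = c \<and> R' rEnd = b \<and> R' rW = i \<and>
      holds_graph n M' (swap_upto y v i) \<and> (\<forall>a\<ge>n * n. M' a = M a) \<and> w' = w" for i R' M' w'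
  show ?thesis
    unfolding swap_com_def
  proof (intro wp_rules)
    show "wp n Orc (While (Minus (Reg rN) (Reg rW))
            (Seq (IfElse outside_expr
                    (Seq (Assign rTmp (Load VW_expr)) (Seq (Store VW_expr (Load V'W_expr)) (Store V'W_expr (Reg rTmp))))
                    Skip) (incr rW))) Q (R(rW := eval R M (Const 0))) M w"
    proof (rule wp_While[OF n2, where N = n and I = I])
      show "I 0 (R(rW := eval R M (Const 0))) M w" using R M by (simp add: I_def)
      show "Q R' M' w'" if "I n R' M' w'" for R' M' w'
        using that Q[of R' M'] by (auto simp: I_def)
      fix i R' M' w' assume i: "i < n" and "I i R' M' w'"
      then have I: "R' rN = n" "R' rV = v" "R' rCnt = c" "R' rEnd = b" "R' rW = i"
        "holds_graph n M' (swap_upto y v i)" "\<And>a. n * n \<le> a \<Longrightarrow> M' a = M a" "w' = w"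
        by (auto simp: I_def)
      show "eval R' M' (Minus (Reg rN) (Reg rW)) \<noteq> 0" using I i by simp
      have out: "eval R' M' outside_expr \<noteq> 0 \<longleftrightarrow> i \<noteq> v \<and> i \<noteq> Suc v"
        by (auto simp: outside_expr_def I)
      show "wp n Orc (Seq (IfElse outside_expr
                    (Seq (Assign rTmp (Load VW_expr)) (Seq (Store VW_expr (Load V'W_expr)) (Store V'W_expr (Reg rTmp))))
                    Skip) (incr rW)) (I (Suc i)) R' M' w'"
      proof (rule wp_rules(1), rule wp_If[OF n2])
        assume "eval R' M' outside_expr = 0"
        then have "swap_upto y v (Suc i) = swap_upto y v i" using out by (auto simp: Let_def)
        then show "wp n Orc Skip (wp n Orc (incr rW) (I (Suc i))) R' M' w'"
          using i I by (intro wp_rules wp_incr) (auto simp: I_def)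
      next
        assume "eval R' M' outside_expr \<noteq> 0"
        then have o: "v \<noteq> i" "Suc v \<noteq> i" using out by auto
        have vn: "v < n" using v by simp
        let ?y = "swap_upto y v i"
        have ld: "M' (pair_index v i) = of_bool ({v, i} \<in> ?y)" "M' (pair_index (Suc v) i) = of_bool ({Suc v, i} \<in> ?y)"
          using holds_graphD[OF I(6) vn i o(1)] holds_graphD[OF I(6) v i o(2)] by auto
        let ?M = "M'(pair_index v i := of_bool ({Suc v, i} \<in> ?y), pair_index (Suc v) i := of_bool ({v, i} \<in> ?y))"
        have h: "holds_graph n ?M (swap_upto y v (Suc i))"
          using holds_graph_set_edge[OF holds_graph_set_edge[OF I(6) vn i o(1)] v i o(2)] o by (simp add: Let_def)
        have f: "\<forall>a\<ge>n * n. ?M a = M a"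
          using pair_index_less[OF vn i o(1)] pair_index_less[OF v i o(2)] I(7) by auto
        show "wp n Orc (Seq (Assign rTmp (Load VW_expr)) (Seq (Store VW_expr (Load V'W_expr)) (Store V'W_expr (Reg rTmp))))
           (wp n Orc (incr rW) (I (Suc i))) R' M' w'"
          using n2 i h f I ld
          by (intro wp_rules wp_incr) (auto simp: VW_expr_def V'W_expr_def eval_edge_expr I_def simp del: swap_upto.simps)
      qed
    next
      show "eval R' M' (Minus (Reg rN) (Reg rW)) = 0" if "I n R' M' w'" for R' M' w'
        using that by (simp add: I_def)
    qed simp
  qed simp
qed

private lemma wp_shake_com:
  assumes K: "2 \<le> K" and R: "R rN = n" "R rCnt = c" "R rEnd = block_end n K x (n - 1)"
    and M: "holds_graph n M x" "\<forall>v<n. M (n * n + v) = of_bool (picked n x v)"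
    and u: "length u = n"
    and Q: "\<And>R' M'. R' rN = n \<Longrightarrow> R' rCnt = c \<Longrightarrow> holds_graph n M' (shake n K x u) \<Longrightarrow> Q R' M' w"
  shows "wp n Orc (shake_com K) Q R M (u @ w)"
proof -
  define b where "b = block_end n K x (n - 1)"
  have b: "K \<le> b \<and> b \<le> n" if "b \<noteq> 0"
    using block_end_twins(1,2)[of n K x "n - 1"] that K n2 by (simp add: b_def)
  define I where "I v R' M' w' \<longleftrightarrow> R' rN = n \<and> R' rV = v \<and> R' rCnt = c \<and> R' rEnd = b \<and>
      holds_graph n M' (walk n K x u v) \<and> (\<forall>v<n. M' (n * n + v) = of_bool (picked n x v)) \<and> w' = drop v u @ w" for v R' M' w'
  let ?body = "Seq (Coin rCoin)
            (Seq (IfElse (Reg rCoin)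
                    (IfElse (Reg rEnd) (toggle_com K) (IfElse (Load flag_expr) swap_com Skip))
                    Skip)
                 (incr rV))"
  show ?thesis
    unfolding shake_com_def
  proof (intro wp_rules)
    show "wp n Orc (While (Minus (Reg rN) (Reg rV)) ?body) Q (R(rV := eval R M (Const 0))) M (u @ w)"
    proof (rule wp_While[OF n2, where N = n and I = I])
      show "I 0 (R(rV := eval R M (Const 0))) M (u @ w)" using R M by (simp add: I_def b_def)
      show "Q R' M' w'" if "I n R' M' w'" for R' M' w'
        using that Q[of R' M'] u by (auto simp: I_def shake_def)
      fix v R' M' w' assume v: "v < n" and "I v R' M' w'"
      then have I: "R' rN = n" "R' rV = v" "R' rCnt = c" "R' rEnd = b"
        "holds_graph n M' (walk n K x u v)" "\<forall>v<n. M' (n * n + v) = of_bool (picked n x v)" "w' = drop v u @ w"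
        by (auto simp: I_def)
      \<comment> \<open>A coin is drawn at every vertex, even if nothing will be done there. So a
        trial consumes exactly \<open>n\<close> coins and coin \<open>v\<close> belongs to vertex
        \<open>v\<close>.\<close>
      have w': "w' = u ! v # drop (Suc v) u @ w" using v u I(7) by (simp add: Cons_nth_drop_Suc)
      let ?R = "R'(rCoin := of_bool (u ! v))"
      have incr: "wp n Orc (incr rV) (I (Suc v)) R'' M'' (drop (Suc v) u @ w)"
        if "R'' rN = n" "R'' rV = v" "R'' rCnt = c" "R'' rEnd = b" "holds_graph n M'' (walk n K x u (Suc v))"
          "\<forall>a\<ge>n * n. M'' a = M' a" for R'' M''
        using that v I(6) by (intro wp_incr) (auto simp: I_def)
      show "eval R' M' (Minus (Reg rN) (Reg rV)) \<noteq> 0" using I v by simp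
      show "wp n Orc ?body (I (Suc v)) R' M' w'"
        unfolding w'
      proof (intro wp_rules(1) wp_Coin[OF n2] wp_If[OF n2])
        assume c: "eval ?R M' (Reg rCoin) \<noteq> 0"
        then have uv: "u ! v" by (simp split: if_splits)
        {
          assume "eval ?R M' (Reg rEnd) \<noteq> 0"
          then have b0: "b \<noteq> 0" using I by simp
          have act: "walk n K x u (Suc v) = (if v \<in> {b - K..<b} then walk n K x u v else toggle_upto (walk n K x u v) (b - K) v K)"
            using uv b0 by (simp add: act_def Let_def b_def)
          show "wp n Orc (toggle_com K) (wp n Orc (incr rV) (I (Suc v))) ?R M' (drop (Suc v) u @ w)"
            using b[OF b0] I v K
            by (intro wp_toggle_com[where v = v and b = b and c = c and y = "walk n K x u v"] incr)
              (auto simp: act simp del: walk.simps)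
        next
          assume "eval ?R M' (Reg rEnd) = 0"
          then have b0: "b = 0" using I by simp
          then have act: "walk n K x u (Suc v) = (if picked n x v then swap_upto (walk n K x u v) v n else walk n K x u v)"
            using uv by (simp add: act_def Let_def b_def)
          have fl: "eval ?R M' (Load flag_expr) = of_bool (picked n x v)"
            using I v by (simp add: flag_expr_def)
          {
            assume "eval ?R M' (Load flag_expr) \<noteq> 0"
            then have p: "picked n x v" unfolding fl by (simp split: if_splits)
            show "wp n Orc swap_com (wp n Orc (incr rV) (I (Suc v))) ?R M' (drop (Suc v) u @ w)"
              using I p
              by (intro wp_swap_com[where v = v and b = b and c = c and y = "walk n K x u v"] incr)
                (auto simp: act picked_def simp del: walk.simps)
          next
            assume "eval ?R M' (Load flag_expr) = 0"
            then have p: "\<not> picked n x v" unfolding fl by (simp split: if_splits)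
            show "wp n Orc Skip (wp n Orc (incr rV) (I (Suc v))) ?R M' (drop (Suc v) u @ w)"
              using I p by (intro wp_rules incr) (auto simp: act simp del: walk.simps)
          }
        }
      next
        assume "eval ?R M' (Reg rCoin) = 0"
        then have uv: "\<not> u ! v" by (simp split: if_splits)
        show "wp n Orc Skip (wp n Orc (incr rV) (I (Suc v))) ?R M' (drop (Suc v) u @ w)"
          using I uv by (intro wp_rules incr) auto
      qed
    next
      show "eval R' M' (Minus (Reg rN) (Reg rV)) = 0" if "I n R' M' w'" for R' M' w'
        using that by (simp add: I_def)
    qed simp
  qed simp
qed

private lemma wp_trial_com:
  assumes K: "2 \<le> K" and R: "R rN = n" "R rCnt = c" "c < n" and M: "holds_graph n M x"
    and u: "length u = n"
    and Q: "\<And>R' M'. R' rN = n \<Longrightarrow> R' rCnt = c + of_bool (Orc (shake n K x u)) \<Longrightarrow>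
       holds_graph n M' (shake n K x u) \<Longrightarrow> Q R' M' w"
  shows "wp n Orc (trial_com K) Q R M (u @ w)"
  unfolding trial_com_def
proof (intro wp_rules(1) wp_scan_com[where x = x and c = c] wp_shake_com[where x = x and c = c and u = u] wp_Query[OF n2] wp_rules(2))
  fix R1 M1 R2 M2
  assume 2: "R2 rN = n" "R2 rCnt = c" "holds_graph n M2 (shake n K x u)"
  let ?R = "R2(rAns := of_bool (Orc (graph_at n (eval R2 M2 (Const 0)) M2)))"
  show "eval ?R M2 (Plus (Reg rCnt) (Reg rAns)) \<le> n" using 2 R by (simp add: of_bool_def)
  show "Q (?R(rCnt := eval ?R M2 (Plus (Reg rCnt) (Reg rAns)))) M2 w"
    using 2 graph_at_holds_graph[OF 2(3)] by (intro Q) auto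
qed (use assms in auto)

private lemma wp_trials_com:
  assumes K: "2 \<le> K"
  shows "R rN = n \<Longrightarrow> R rCnt = c \<Longrightarrow> c + m \<le> n \<Longrightarrow> holds_graph n M x \<Longrightarrow> m * n \<le> length w \<Longrightarrow>
    (\<And>R' M' w'. R' rN = n \<Longrightarrow> R' rCnt = c + wins (shake n K) Orc n m x w \<Longrightarrow> Q R' M' w') \<Longrightarrow>
    wp n Orc (trials_com K m) Q R M w"
proof (induction m arbitrary: R M x w c)
  case 0
  then show ?case by (simp add: wp_rules)
next
  case (Suc m)
  let ?u = "take n w"
  have len: "length ?u = n" using Suc.prems(5) by simp
  have "wp n Orc (trial_com K) (wp n Orc (trials_com K m) Q) R M (?u @ drop n w)"
  proof (rule wp_trial_com[where c = c and x = x, OF K])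
    fix R' M' assume "R' rN = n" "R' rCnt = c + of_bool (Orc (shake n K x ?u))" "holds_graph n M' (shake n K x ?u)"
    then show "wp n Orc (trials_com K m) Q R' M' (drop n w)"
      using Suc.prems
      by (intro Suc.IH[where x = "shake n K x ?u" and c = "c + of_bool (Orc (shake n K x ?u))"]) (auto simp: of_bool_def)
  qed (use Suc.prems len in auto)
  then show ?case by (simp add: wp_rules)
qed

text \<open>The condition \<open>m \<le> n\<close> keeps the answer counter within the bound
  \<open>n\<close> imposed on registers.\<close>

lemma reduction_com_run:
  assumes K: "2 \<le> K" and m: "m \<le> n" and x: "x \<in> graphs n" and w: "m * n \<le> length w"
  obtains t R M w' where
    "steps n Orc (reduction_com K m) (init_regs n) (init_mem n x) w t R M w'"
    "t \<le> time_bound n (reduction_com K m)"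
    "R 0 = of_bool (m < 2 * wins (shake n K) Orc n m x w)"
proof -
  let ?c = "wins (shake n K) Orc n m x w"
  have "wp n Orc (reduction_com K m) (\<lambda>R M w'. R 0 = of_bool (m < 2 * ?c)) (init_regs n) (init_mem n x) w"
    unfolding reduction_com_def
  proof (intro wp_rules(1) wp_trials_com[OF K, where c = 0 and x = x])
    fix R M and w' :: "bool list" assume R: "R rN = n" "R rCnt = 0 + ?c"
    show "wp n Orc (IfElse (Minus (Times (Const 2) (Reg rCnt)) (Const m)) (Assign rN (Const 1)) (Assign rN (Const 0)))
        (\<lambda>R M w'. R 0 = of_bool (m < 2 * ?c)) R M w'"
      using R n2 by (intro wp_If[OF n2] wp_rules) auto
  qed (use assms holds_graph_init_mem[OF x] in \<open>auto simp: init_regs_def\<close>)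
  moreover have "bounded_state n (init_regs n) (init_mem n x)"
    using n2 by (auto simp: bounded_state_def init_regs_def init_mem_def)
  ultimately show ?thesis unfolding wp_def[OF n2] using that by blast
qed

end

subsection \<open>Success of the reduction\<close>

lemma reduction_succeeds:
  fixes \<delta> :: real
  assumes n: "2 \<le> n" "m \<le> n" and k: "3 \<le> (2::nat) ^ k" and \<delta>: "0 < \<delta>" "\<delta> < 1 / 2"
    and m: "(1 - 2 * \<delta>\<^sup>2) ^ m < 1 / 3" and Orc: "Orc \<in> oracles (clique_parity k n) S"
    and good: "\<And>x. x \<in> graphs n \<Longrightarrow>
      real (card {u. length u = n \<and> shake n (2 ^ k) x u \<notin> S}) \<le> (1 / 2 - \<delta>) * 2 ^ n"
    and T: "time_bound n (reduction_com (2 ^ k) m) \<le> T" "m * n \<le> T"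
  shows "randomized_reduction n (clique_parity k n) Orc (reduction_com (2 ^ k) m) T"
  unfolding randomized_reduction_def
proof (intro ballI conjI allI impI)
  let ?f = "shake n (2 ^ k)" and ?H = "clique_parity k n"
  have K: "2 \<le> (2::nat) ^ k" using k by simp
  fix x assume x: "x \<in> graphs n"
  note run = reduction_com_run[OF n(1) K n(2) x]
  show "halts_within n Orc (reduction_com (2 ^ k) m) x w T" if "length w = T" for w
    using run[of w Orc] that T unfolding halts_within_def by (metis le_trans)
  define g where "g y \<longleftrightarrow> Orc y = ?H x" for y
  \<comment> \<open>All trials stay in the parity class of \<open>x\<close>, where an answer from
    \<open>S\<close> equals the wanted bit. Nothing else about \<open>Orc\<close> enters, so every
    oracle compatible with \<open>S\<close> is covered.\<close>
  define I where "I = {y \<in> graphs n. ?H y = ?H x}"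
  let ?bad = "{w. length w = T \<and> 2 * wins ?f g n m x w \<le> m}"
  have closed: "?f y u \<in> I" if "y \<in> I" for y u
    using that shake_graphs[OF _ K] clique_parity_shake[OF _ k] by (simp add: I_def)
  have "real (card {u. length u = n \<and> \<not> g (?f y u)}) \<le> (1 / 2 - \<delta>) * 2 ^ n" if y: "y \<in> I" for y
  proof -
    have "{u. length u = n \<and> \<not> g (?f y u)} \<subseteq> {u. length u = n \<and> ?f y u \<notin> S}"
      using Orc closed[OF y] by (auto simp: oracles_def g_def I_def)
    then have "card {u. length u = n \<and> \<not> g (?f y u)} \<le> card {u. length u = n \<and> ?f y u \<notin> S}"
      by (rule card_mono[rotated]) (simp add: finite_bool_lists)
    then show ?thesis using good[of y] y by (simp add: I_def)
  qed
  \<comment> \<open>The \<open>T - m * n\<close> coins left over at the end are the surplus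
    \<open>r\<close>.\<close>
  from card_minority_wins_le[OF \<delta> closed this, where x = x and m = m and r = "T - m * n"] x T(2)
  have "real (card ?bad) \<le> (1 - 2 * \<delta>\<^sup>2) ^ m * 2 ^ T" by (simp add: I_def)
  also have "\<dots> < 1 / 3 * 2 ^ T" using m by (intro mult_strict_right_mono) auto
  finally have bad: "real (card ?bad) < 1 / 3 * 2 ^ T" .
  have out: "{w. length w = T} - ?bad \<subseteq> {w. outputs n Orc (reduction_com (2 ^ k) m) x w (?H x)}"
  proof
    fix w assume "w \<in> {w. length w = T} - ?bad"
    then have w: "length w = T" and win: "m < 2 * wins ?f g n m x w" by auto
    \<comment> \<open>For odd parity correct answers are the positive ones. For even parity the
      counts are complementary, and the strict majority of correct answers leaves a strict minority
      of positive ones.\<close>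
    have "?H x \<longleftrightarrow> m < 2 * wins ?f Orc n m x w"
    proof (cases "?H x")
      case True
      then have "g = Orc" by (auto simp: g_def)
      then show ?thesis using win True by simp
    next
      case False
      then have "g = (\<lambda>y. \<not> Orc y)" by (auto simp: g_def)
      then show ?thesis using win False wins_Not[of ?f Orc n m x w] by simp
    qed
    obtain t R M w' where "steps n Orc (reduction_com (2 ^ k) m) (init_regs n) (init_mem n x) w t R M w'"
      and "R 0 = of_bool (m < 2 * wins ?f Orc n m x w)"
      using run[of w Orc] w T(2) by metis
    moreover from this(2) \<open>?H x \<longleftrightarrow> _\<close> have "R 0 = of_bool (?H x)" by simp
    ultimately show "w \<in> {w. outputs n Orc (reduction_com (2 ^ k) m) x w (?H x)}"
      unfolding outputs_def by blast
  qed
  have fin: "finite {w :: bool list. length w = T}" by (rule finite_bool_lists)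
  have "?bad \<subseteq> {w. length w = T}" by blast
  then have "real (card ({w. length w = T} - ?bad)) = 2 ^ T - real (card ?bad)"
    using fin card_mono[OF fin] by (simp add: card_Diff_subset finite_subset card_bool_lists of_nat_diff)
  then have "2 / 3 * 2 ^ T < real (card ({w. length w = T} - ?bad))" using bad by simp
  also have "\<dots> \<le> real (card ({w. length w = T} \<inter> {w. outputs n Orc (reduction_com (2 ^ k) m) x w (?H x)}))"
    using out fin by (intro of_nat_mono card_mono) auto
  finally have large: "2 / 3 * 2 ^ T
    < real (card ({w. length w = T} \<inter> {w. outputs n Orc (reduction_com (2 ^ k) m) x w (?H x)}))" .
  have ne: "{w :: bool list. length w = T} \<noteq> {}" using Ex_list_of_length by blast
  show "2 / 3 < measure_pmf.prob (coins T) {w. outputs n Orc (reduction_com (2 ^ k) m) x w (?H x)}"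
    unfolding coins_def measure_pmf_of_set[OF ne fin] using large by (simp add: card_bool_lists field_simps)
qed

lemma sum_card_fibres:
  assumes "finite L" "finite B"
  shows "(\<Sum>y\<in>B. card {u \<in> L. f u = y}) = card {u \<in> L. f u \<in> B}"
proof -
  have "{u \<in> L. f u \<in> B} = (\<Union>y\<in>B. {u \<in> L. f u = y})" by blast
  moreover have "card (\<Union>y\<in>B. {u \<in> L. f u = y}) = (\<Sum>y\<in>B. card {u \<in> L. f u = y})"
    using assms by (intro card_UN_disjoint) auto
  ultimately show ?thesis by simp
qed

text \<open>The deviation bound with \<open>p\<close> the distribution of the query from
  \<open>x\<close> and \<open>P\<close> its min-entropy bound. The hypothesis leaves
  \<open>2 * \<delta>\<close> between the missing density and 1/2: half for the deviation of
  \<open>S\<close>, half as the advantage of a trial.\<close>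

lemma bad_instance_prob:
  fixes \<delta> :: real and s :: nat
  assumes x: "x \<in> graphs n" and K: "2 \<le> K" "2 * K \<le> n" and s: "s \<le> 2 ^ (n choose 2)"
    and \<delta>: "0 < \<delta>" "\<delta> \<le> 1" and q: "real (2 ^ (n choose 2) - s) / 2 ^ (n choose 2) \<le> 1 / 2 - 2 * \<delta>"
  shows "real (card {S. S \<subseteq> graphs n \<and> card S = s \<and>
            (1 / 2 - \<delta>) * 2 ^ n < real (card {u. length u = n \<and> shake n K x u \<notin> S})})
     \<le> exp (- \<delta>\<^sup>2 * 2 ^ ((n - 1) div K div 3) / 2) * real (2 ^ (n choose 2) choose s)"
proof -
  let ?h = "(n - 1) div K div 3" and ?G = "graphs n" and ?L = "{u :: bool list. length u = n}"
  let ?q = "real (2 ^ (n choose 2) - s) / 2 ^ (n choose 2)"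
  define p where "p y = real (card {u \<in> ?L. shake n K x u = y}) / 2 ^ n" for y
  have G: "finite ?G" "?G \<noteq> {}" using card_graphs x by auto
  have fL: "finite ?L" by (rule finite_bool_lists)
  have inG: "shake n K x u \<in> ?G" for u by (rule shake_graphs[OF x K(1)])
  have sum_p: "sum p (?G - S) = real (card {u. length u = n \<and> shake n K x u \<notin> S}) / 2 ^ n" for S
  proof -
    have "sum p (?G - S) = real (\<Sum>y\<in>?G - S. card {u \<in> ?L. shake n K x u = y}) / 2 ^ n"
      by (simp add: p_def sum_divide_distrib)
    also have "(\<Sum>y\<in>?G - S. card {u \<in> ?L. shake n K x u = y}) = card {u \<in> ?L. shake n K x u \<in> ?G - S}"
      using G fL by (intro sum_card_fibres) auto
    finally show ?thesis using inG by simp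
  qed
  have "n \<ge> ?h" by (meson diff_le_self div_le_dividend le_trans)
  then have p_le: "p y \<le> 1 / 2 ^ ?h" for y
  proof -
    have "card {u \<in> ?L. shake n K x u = y} \<le> 2 ^ (n - ?h)"
      using card_shake_eq_le[OF x K, of y] by simp
    then have "card {u \<in> ?L. shake n K x u = y} * 2 ^ ?h \<le> 2 ^ (n - ?h) * 2 ^ ?h"
      by (intro mult_right_mono) auto
    also have "\<dots> = 2 ^ n" using \<open>n \<ge> ?h\<close> by (simp flip: power_add)
    finally have "real (card {u \<in> ?L. shake n K x u = y} * 2 ^ ?h) \<le> real (2 ^ n)"
      by (rule of_nat_mono)
    then show ?thesis by (simp add: p_def field_simps)
  qed
  have "real (card {S. S \<subseteq> ?G \<and> card S = s \<and> ?q + \<delta> \<le> sum p (?G - S)})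
      \<le> exp (- \<delta>\<^sup>2 / (2 * (1 / 2 ^ ?h))) * real (card ?G choose s)"
  proof (rule random_set_deviation[OF G])
    show "sum p ?G = 1" using sum_p[of "{}"] by (simp add: card_bool_lists)
    show "?q \<le> 1 / 2" using q \<delta> by linarith
  qed (use s \<delta> p_le in \<open>auto simp: card_graphs p_def\<close>)
  moreover have "card {S. S \<subseteq> ?G \<and> card S = s \<and>
            (1 / 2 - \<delta>) * 2 ^ n < real (card {u. length u = n \<and> shake n K x u \<notin> S})}
      \<le> card {S. S \<subseteq> ?G \<and> card S = s \<and> ?q + \<delta> \<le> sum p (?G - S)}"
  proof (rule card_mono)
    show "finite {S. S \<subseteq> ?G \<and> card S = s \<and> ?q + \<delta> \<le> sum p (?G - S)}"
      using G by simp
    have "?q + \<delta> \<le> sum p (?G - S)" if "(1 / 2 - \<delta>) * 2 ^ n < real (card {u. length u = n \<and> shake n K x u \<notin> S})" for S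
    proof -
      have "1 / 2 - \<delta> < sum p (?G - S)" using that unfolding sum_p by (simp add: field_simps)
      then show ?thesis using q by linarith
    qed
    then show "{S. S \<subseteq> ?G \<and> card S = s \<and> (1 / 2 - \<delta>) * 2 ^ n < real (card {u. length u = n \<and> shake n K x u \<notin> S})}
      \<subseteq> {S. S \<subseteq> ?G \<and> card S = s \<and> ?q + \<delta> \<le> sum p (?G - S)}" by blast
  qed
  ultimately show ?thesis by (simp add: card_graphs)
qed

text \<open>A union bound over all start graphs. The term \<open>1 / 2 ^ (n choose 2)\<close> pays
  for rounding the size of \<open>S\<close> down to an integer.\<close>

lemma good_oracle_prob:
  fixes \<delta> c :: real
  assumes K: "2 \<le> K" "2 * K \<le> n" and c: "0 \<le> c" "c \<le> 1"
    and \<delta>: "0 < \<delta>" "\<delta> \<le> 1" and q: "1 - c + 1 / 2 ^ (n choose 2) \<le> 1 / 2 - 2 * \<delta>"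
  shows "1 - 2 ^ (n choose 2) * exp (- \<delta>\<^sup>2 * 2 ^ ((n - 1) div K div 3) / 2)
    \<le> measure_pmf.prob (oracle_experiment n c)
        {S. \<forall>x\<in>graphs n. real (card {u. length u = n \<and> shake n K x u \<notin> S}) \<le> (1 / 2 - \<delta>) * 2 ^ n}"
proof -
  let ?N = "2 ^ (n choose 2) :: nat" and ?s = "nat \<lfloor>c * 2 ^ (n choose 2)\<rfloor>"
  let ?e = "exp (- \<delta>\<^sup>2 * 2 ^ ((n - 1) div K div 3) / 2)"
  define good where "good = {S. \<forall>x\<in>graphs n. real (card {u. length u = n \<and> shake n K x u \<notin> S}) \<le> (1 / 2 - \<delta>) * 2 ^ n}"
  define bad where "bad x = {S. S \<subseteq> graphs n \<and> card S = ?s \<and>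
            (1 / 2 - \<delta>) * 2 ^ n < real (card {u. length u = n \<and> shake n K x u \<notin> S})}" for x
  note cs = correct_sets_nonempty[OF c, of n]
  have card_cs: "card (correct_sets n c) = ?N choose ?s"
    unfolding correct_sets_def using n_subsets[of "graphs n" ?s] card_graphs by simp
  have "c * 2 ^ (n choose 2) \<le> 1 * 2 ^ (n choose 2)" using c by (intro mult_right_mono) auto
  moreover have "real ?s = real_of_int \<lfloor>c * 2 ^ (n choose 2)\<rfloor>" using c by simp
  ultimately have s: "real ?s \<le> 2 ^ (n choose 2)" "c * 2 ^ (n choose 2) - 1 \<le> real ?s"
    by linarith+
  then have sN: "?s \<le> ?N" by (metis of_nat_le_iff of_nat_numeral of_nat_power)
  have "real (?N - ?s) = 2 ^ (n choose 2) - real ?s" using sN by (simp add: of_nat_diff)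
  then have "real (?N - ?s) / 2 ^ (n choose 2) \<le> (2 ^ (n choose 2) - (c * 2 ^ (n choose 2) - 1)) / 2 ^ (n choose 2)"
    using s by (intro divide_right_mono) auto
  also have "\<dots> = 1 - c + 1 / 2 ^ (n choose 2)" by (simp add: field_simps)
  finally have q': "real (?N - ?s) / 2 ^ (n choose 2) \<le> 1 / 2 - 2 * \<delta>" using q by linarith
  have "real (card (correct_sets n c - good)) \<le> real (card (\<Union>x\<in>graphs n. bad x))"
  proof (intro of_nat_mono card_mono)
    show "finite (\<Union>x\<in>graphs n. bad x)" using card_graphs by (auto simp: bad_def)
    show "correct_sets n c - good \<subseteq> (\<Union>x\<in>graphs n. bad x)"
      by (auto simp: correct_sets_def good_def bad_def not_le)
  qed
  also have "\<dots> \<le> (\<Sum>x\<in>graphs n. real (card (bad x)))"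
    using card_UN_le[of "graphs n" bad] card_graphs by (simp flip: of_nat_sum)
  also have "\<dots> \<le> (\<Sum>x\<in>graphs n. ?e * real (?N choose ?s))"
    unfolding bad_def by (intro sum_mono bad_instance_prob K sN \<delta> q')
  finally have b: "real (card (correct_sets n c - good)) \<le> 2 ^ (n choose 2) * ?e * real (card (correct_sets n c))"
    by (simp add: card_graphs card_cs)
  have pos: "0 < real (card (correct_sets n c))" using cs by (simp add: card_gt_0_iff)
  have "card (correct_sets n c) = card (correct_sets n c \<inter> good) + card (correct_sets n c - good)"
    using cs(1) by (rule card_Int_Diff)
  then have "real (card (correct_sets n c)) * (1 - 2 ^ (n choose 2) * ?e) \<le> real (card (correct_sets n c \<inter> good))"
    using b by (simp add: algebra_simps)
  then have "1 - 2 ^ (n choose 2) * ?e \<le> real (card (correct_sets n c \<inter> good)) / real (card (correct_sets n c))"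
    using pos by (simp add: field_simps)
  then show ?thesis
    unfolding oracle_experiment_def measure_pmf_of_set[OF cs(2,1)] good_def .
qed

subsection \<open>Asymptotics\<close>

lemma failure_bound:
  fixes \<delta> :: real
  assumes \<delta>: "0 < \<delta>" and K: "0 < K"
  shows "\<forall>\<^sub>F n in sequentially.
    2 ^ (n choose 2) * exp (- \<delta>\<^sup>2 * 2 ^ ((n - 1) div K div 3) / 2) \<le> 2 powr (- 1 * real n ^ 2)"
proof -
  define a where "a = 1 / (3 * real K)"
  have a: "0 < a" using K by (simp add: a_def)
  \<comment> \<open>Of the two multiples of \<open>n ^ 2\<close> one pays for the number of graphs
    and one remains as the final bound. The \<open>- 2\<close> absorbs the floors and the
    \<open>n - 1\<close> in the exponent.\<close>
  have "\<forall>\<^sub>F n in sequentially. 2 * real n ^ 2 * ln 2 \<le> \<delta>\<^sup>2 / 2 * 2 powr (a * real n - 2)"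
    using \<delta> a by real_asymp
  then show ?thesis
    using eventually_ge_at_top[of 1]
  proof eventually_elim
    case (elim n)
    let ?h = "(n - 1) div K div 3"
    have "real (n - 1) / real (K * 3) < real ((n - 1) div (K * 3)) + 1"
      using divide_nat_diff_div_nat_less_one[of "n - 1" "K * 3"] by linarith
    then have "a * real n - a - 1 < real ?h" using elim(2) K
      by (simp add: div_mult2_eq a_def field_simps)
    moreover have "a \<le> 1" using K by (simp add: a_def)
    ultimately have "2 powr (a * real n - 2) \<le> 2 powr real ?h" by (intro powr_mono) auto
    then have "2 powr (a * real n - 2) \<le> 2 ^ ?h" by (simp add: powr_realpow)
    then have "\<delta>\<^sup>2 / 2 * 2 powr (a * real n - 2) \<le> \<delta>\<^sup>2 / 2 * 2 ^ ?h" by (intro mult_left_mono) auto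
    then have "exp (- \<delta>\<^sup>2 * 2 ^ ?h / 2) \<le> exp (- 2 * real n ^ 2 * ln 2)"
      using elim(1) by simp
    also have "\<dots> = 2 powr (- 2 * real n ^ 2)" by (simp add: powr_def)
    finally have e: "exp (- \<delta>\<^sup>2 * 2 ^ ?h / 2) \<le> 2 powr (- 2 * real n ^ 2)" .
    have "n choose 2 \<le> n * (n - 1)" by (simp add: choose_two)
    also have "\<dots> \<le> n * n" by simp
    finally have "real (n choose 2) \<le> real n ^ 2" by (simp add: power2_eq_square flip: of_nat_mult)
    then have "(2::real) powr real (n choose 2) \<le> 2 powr (real n ^ 2)" by (intro powr_mono) auto
    then have "(2::real) ^ (n choose 2) \<le> 2 powr (real n ^ 2)" by (simp add: powr_realpow)
    then have "2 ^ (n choose 2) * exp (- \<delta>\<^sup>2 * 2 ^ ?h / 2) \<le> 2 powr (real n ^ 2) * 2 powr (- 2 * real n ^ 2)"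
      using e by (intro mult_mono) auto
    also have "\<dots> = 2 powr (- 1 * real n ^ 2)" by (simp add: powr_add[symmetric])
    finally show ?case .
  qed
qed

lemma soft_O_quadratic: "(\<lambda>n. real (C * (n ^ 2 * floorlog 2 n))) \<in> soft_O (\<lambda>n. real n ^ 2)"
proof -
  have "(\<lambda>n. real (C * (n ^ 2 * floorlog 2 n))) \<in> O(\<lambda>n. real n ^ 2 * ln (real n) ^ 1)"
  proof (rule bigoI[where c = "real C * (2 / ln 2)"])
    show "\<forall>\<^sub>F n in sequentially. norm (real (C * (n ^ 2 * floorlog 2 n)))
        \<le> real C * (2 / ln 2) * norm (real n ^ 2 * ln (real n) ^ 1)"
      using eventually_ge_at_top[of 2]
    proof eventually_elim
      case (elim n)
      have l: "1 \<le> log 2 (real n)" using elim by simp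
      have "floorlog 2 n = nat \<lfloor>log 2 (real n)\<rfloor> + 1" using elim by (simp add: floorlog_def)
      then have "real (floorlog 2 n) \<le> log 2 (real n) + 1" using l by simp
      also have "\<dots> \<le> 2 * log 2 (real n)" using l by simp
      also have "\<dots> = 2 / ln 2 * ln (real n)" by (simp add: log_def)
      finally have "real C * (real n ^ 2 * real (floorlog 2 n)) \<le> real C * (real n ^ 2 * (2 / ln 2 * ln (real n)))"
        by (intro mult_left_mono) auto
      then show ?case using elim by (simp add: mult_ac)
    qed
  qed
  then show ?thesis unfolding soft_O_def by blast
qed

theorem theorem2:
  fixes k :: nat and \<epsilon> :: real
  assumes "k > 2" and "0 < \<epsilon>" and "\<epsilon> \<le> 1 / 2"
  shows "\<exists>(p :: com) (T :: nat \<Rightarrow> nat) (c :: real).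
           (\<lambda>n. real (T n)) \<in> soft_O (\<lambda>n. real n ^ 2) \<and> c > 0 \<and>
           (\<forall>\<^sub>F n in sequentially.
              measure_pmf.prob (oracle_experiment n (1 / 2 + \<epsilon>))
                {S. \<forall>Orc \<in> oracles (clique_parity k n) S.
                      randomized_reduction n (clique_parity k n) Orc p (T n)}
              \<ge> 1 - 2 powr (- c * real n ^ 2))"
proof -
  \<comment> \<open>Of \<open>\<epsilon> = 4 * \<delta>\<close>, two parts form the gap required
    below 1/2 and the rest is room for the rounding of the size of \<open>S\<close>.\<close>
  define \<delta> where "\<delta> = \<epsilon> / 4"
  have \<delta>: "0 < \<delta>" "\<delta> < 1 / 2" "\<delta> \<le> 1" using assms by (auto simp: \<delta>_def)
  let ?K = "2 ^ k :: nat"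
  have "(2::nat) ^ 2 \<le> 2 ^ k" using assms by (intro power_increasing) auto
  then have K: "3 \<le> ?K" "2 \<le> ?K" "0 < ?K" by auto
  have "1 - 2 * \<delta>\<^sup>2 < 1" using \<delta> by simp
  \<comment> \<open>The number of trials depends on \<open>\<delta>\<close> alone; the failure
    probability below 1/3 is what the majority needs.\<close>
  from real_arch_pow_inv[OF _ this, of "1 / 3"]
  obtain m where m: "(1 - 2 * \<delta>\<^sup>2) ^ m < 1 / 3" by auto
  let ?p = "reduction_com ?K m"
  \<comment> \<open>The summand \<open>m\<close> makes \<open>T n\<close> large enough to supply the
    \<open>m * n\<close> coins as well as to bound the time.\<close>
  define T where "T n = (time_coeff ?p + m) * (n ^ 2 * floorlog 2 n)" for n
  have "\<forall>\<^sub>F n in sequentially. 1 - 2 powr (- 1 * real n ^ 2) \<le>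
      measure_pmf.prob (oracle_experiment n (1 / 2 + \<epsilon>))
        {S. \<forall>Orc \<in> oracles (clique_parity k n) S. randomized_reduction n (clique_parity k n) Orc ?p (T n)}"
    \<comment> \<open>The threshold on \<open>n\<close> includes \<open>1 / \<delta>\<close> so that
      the rounding term drops below \<open>\<delta>\<close>.\<close>
    using failure_bound[OF \<delta>(1) K(3)] eventually_ge_at_top[of "2 * ?K + m + nat \<lceil>1 / \<delta>\<rceil> + 2"]
  proof eventually_elim
    case (elim n)
    have n: "2 \<le> n" "m \<le> n" "2 * ?K \<le> n" "1 / \<delta> \<le> real (n - 1)" using elim(2) by linarith+
    have L: "1 \<le> floorlog 2 n" using n by (intro floorlog_geI) auto
    have "time_bound n ?p \<le> time_coeff ?p * (n ^ 2 * floorlog 2 n)"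
      by (rule time_bound_le[OF n(1) time_degree_reduction_com])
    then have T1: "time_bound n ?p \<le> T n" by (simp add: T_def add_mult_distrib)
    have "n * 1 \<le> n ^ 2 * floorlog 2 n" using L n by (intro mult_mono) (auto simp: power2_eq_square)
    then have "m * n \<le> m * (n ^ 2 * floorlog 2 n)" by (intro mult_left_mono) auto
    then have T2: "m * n \<le> T n" unfolding T_def add_mult_distrib by (rule trans_le_add2)
    have "n - 1 \<le> n choose 2" using n by (cases n) (auto simp: numeral_2_eq_2)
    also have "\<dots> \<le> 2 ^ (n choose 2)" by (simp add: less_imp_le)
    finally have "real (n - 1) \<le> 2 ^ (n choose 2)" by (metis of_nat_le_iff of_nat_numeral of_nat_power)
    then have "1 / \<delta> \<le> 2 ^ (n choose 2)" using n(4) by linarith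
    then have q: "1 - (1 / 2 + \<epsilon>) + 1 / 2 ^ (n choose 2) \<le> 1 / 2 - 2 * \<delta>"
      using \<delta> by (simp add: \<delta>_def field_simps)
    have "1 - 2 powr (- 1 * real n ^ 2) \<le> 1 - 2 ^ (n choose 2) * exp (- \<delta>\<^sup>2 * 2 ^ ((n - 1) div ?K div 3) / 2)"
      using elim(1) by linarith
    also have "\<dots> \<le> measure_pmf.prob (oracle_experiment n (1 / 2 + \<epsilon>))
        {S. \<forall>x\<in>graphs n. real (card {u. length u = n \<and> shake n ?K x u \<notin> S}) \<le> (1 / 2 - \<delta>) * 2 ^ n}"
      using assms by (intro good_oracle_prob K n \<delta> q) auto
    also have "\<dots> \<le> measure_pmf.prob (oracle_experiment n (1 / 2 + \<epsilon>))
        {S. \<forall>Orc \<in> oracles (clique_parity k n) S. randomized_reduction n (clique_parity k n) Orc ?p (T n)}"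
      using reduction_succeeds[OF n(1,2) K(1) \<delta>(1,2) m _ _ T1 T2]
      by (intro measure_pmf.finite_measure_mono) auto
    finally show ?case .
  qed
  moreover have "(\<lambda>n. real (T n)) \<in> soft_O (\<lambda>n. real n ^ 2)"
    unfolding T_def by (rule soft_O_quadratic)
  ultimately show ?thesis by (intro exI[of _ ?p] exI[of _ T] exI[of _ 1]) auto
qed

end
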